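(* Let $\rho>0$ and put $\delta_{n,\rho}=\frac{\rho+1}{n\rho+1}$. There is a constant $C_{\rho}>0$, independent of $n$, $f$, $g$ and $x$, such that for all real-valued $f,g\in C^{1}[0,1]$, all $n\ge1$ and all $x\in[0,1]$, $$n\left|U_{n}^{\rho}(fg)(x)-U_{n}^{\rho}(f)(x)U_{n}^{\rho}(g)(x)-\frac{\rho+1}{\rho n}x(1-x)f'(x)g'(x)\right|\le C_{\rho}\frac{\rho+1}{\rho}x(1-x)\Big\{\omega_{3}(f';\delta_{n,\rho}^{1/6})\,\omega_{3}(g';\delta_{n,\rho}^{1/6})$$ $$+\|f'\|\,\omega_{3}(g';\delta_{n,\rho}^{1/6})+\|g'\|\,\omega_{3}(f';\delta_{n,\rho}^{1/6})+\max\{\delta_{n,\rho}^{1/2}\|f\|,\omega_{3}(f';\delta_{n,\rho}^{1/6})\}\cdot\max\{\delta_{n,\rho}^{1/2}\|g\|,\omega_{3}(g';\delta_{n,\rho}^{1/6})\}\Big\}.$$ Moreover, the constants $C_{\rho}$ remain bounded as $\rho\to\infty$.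
   Context: For $\rho>0$, $n\in\mathbb{N}$, $f\in C[0,1]$, $x\in[0,1]$, the Păltănea operators are $$U_{n}^{\rho}(f)(x)=\sum_{k=1}^{n-1}\Big(\int_{0}^{1}f(t)\mu_{n,k}^{\rho}(t)\,dt\Big)p_{n,k}(x)+f(0)(1-x)^{n}+f(1)x^{n},$$ where $p_{n,k}(x)=\binom{n}{k}x^{k}(1-x)^{n-k}$, $\mu_{n,k}^{\rho}(t)=\frac{t^{k\rho-1}(1-t)^{(n-k)\rho-1}}{B(k\rho,(n-k)\rho)}$ for $1\le k\le n-1$, and $B(a,b)=\int_{0}^{1}t^{a-1}(1-t)^{b-1}dt$ is Euler's Beta function. $\|\cdot\|$ denotes the uniform norm on $C[0,1]$. For $h\in C[0,1]$ and $\delta>0$, $\omega_{3}(h;\delta)=\sup\{|h(x+3t)-3h(x+2t)+3h(x+t)-h(x)| : 0<t\le\delta,\ x,x+3t\in[0,1]\}$. *)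

theory Defs
  imports "HOL-Analysis.Analysis"
begin

definition bern :: "nat \<Rightarrow> nat \<Rightarrow> real \<Rightarrow> real" where
  "bern n k x = real (n choose k) * x ^ k * (1 - x) ^ (n - k)"

definition mu :: "real \<Rightarrow> nat \<Rightarrow> nat \<Rightarrow> real \<Rightarrow> real" where
  "mu \<rho> n k t = t powr (real k * \<rho> - 1) * (1 - t) powr (real (n - k) * \<rho> - 1)
                  / Beta (real k * \<rho>) (real (n - k) * \<rho>)"

definition paltanea :: "real \<Rightarrow> nat \<Rightarrow> (real \<Rightarrow> real) \<Rightarrow> real \<Rightarrow> real" where
  "paltanea \<rho> n f x =
     (\<Sum>k = 1..n - 1. integral {0..1} (\<lambda>t. f t * mu \<rho> n k t) * bern n k x)
     + f 0 * (1 - x) ^ n + f 1 * x ^ n"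

definition supnorm :: "(real \<Rightarrow> real) \<Rightarrow> real" where
  "supnorm h = (SUP x\<in>{0..1}. \<bar>h x\<bar>)"

definition omega3 :: "(real \<Rightarrow> real) \<Rightarrow> real \<Rightarrow> real" where
  "omega3 h \<delta> = Sup {\<bar>h (x + 3*t) - 3 * h (x + 2*t) + 3 * h (x + t) - h x\<bar> | x t.
                     0 < t \<and> t \<le> \<delta> \<and> 0 \<le> x \<and> x + 3*t \<le> 1}"

definition C1_01 :: "(real \<Rightarrow> real) \<Rightarrow> (real \<Rightarrow> real) \<Rightarrow> bool" where
  "C1_01 f f' \<longleftrightarrow> (\<forall>x\<in>{0..1}. (f has_real_derivative f' x) (at x within {0..1}))
                     \<and> continuous_on {0..1} f'"

end

theory Submission
  imports Defs
begin

text \<open>Put \<open>X = x(1 - x)\<close>, \<open>s = \<delta>\<^sup>1\<^sup>/\<^sup>6\<close>, so that \<open>s\<^sup>3 = \<delta>\<^sup>1\<^sup>/\<^sup>2\<close>, let \<open>\<omega>\<close> be the modulus of \<open>f'\<close> at \<open>s\<close>,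
  \<open>M = max {s\<^sup>3 \<parallel>f\<parallel>, \<omega>}\<close> and \<open>N = M / s\<^sup>3\<close>. Smoothing \<open>f'\<close> by a third order Steklov mean with step
  proportional to \<open>s\<close> and Taylor expanding the result at \<open>x\<close> gives, with an absolute constant \<open>K\<close>,
  \<open>f(t) = f(x) + f'(x)(t - x) + a(t - x)\<^sup>2 + R(t)\<close>, where \<open>\<bar>a\<bar>\<close> and \<open>\<bar>f'(x)\<bar>\<close> are at most \<open>K N\<close> and
  \<open>\<bar>R(t)\<bar> \<le> K(\<omega>\<bar>t - x\<bar> + N\<bar>t - x\<bar>\<^sup>3)\<close>; the same holds for \<open>g\<close>. Inserting both expansions into the
  covariance \<open>U(fg) - U(f)U(g)\<close>, the leading term is \<open>f'(x)g'(x)\<close> times the variance \<open>\<delta>X\<close>, and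
  all other terms are controlled because the third and fourth central moments of \<open>U\<close> are
  \<open>O(\<delta>\<^sup>2 X)\<close>. The bounds \<open>n\<delta> \<le> (\<rho> + 1) / \<rho>\<close> and
  \<open>(\<rho> + 1) / (\<rho>n) - \<delta> = \<delta> / (\<rho>n)\<close> finish the proof, with a constant independent of \<open>\<rho>\<close>.\<close>

section \<open>Moments of the operators\<close>

definition bern_sum :: "nat \<Rightarrow> real \<Rightarrow> (nat \<Rightarrow> real) \<Rightarrow> real" where
  "bern_sum n x \<phi> = (\<Sum>k\<le>n. \<phi> k * bern n k x)"

lemma bern_Suc:
  assumes "k \<le> n"
  shows "bern (Suc n) (Suc k) x = x * bern n k x + (1 - x) * bern n (Suc k) x"
proof (cases "k = n")
  case True
  then show ?thesis by (simp add: bern_def)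
next
  case False
  then have "n - k = Suc (n - Suc k)" using assms by auto
  then show ?thesis by (simp add: bern_def algebra_simps)
qed

text \<open>In probabilistic terms this conditions on one of \<open>n + 1\<close> Bernoulli trials:
  a success, of probability \<open>x\<close>, shifts the argument of \<open>\<phi>\<close> by one.
  Moments then follow by induction on \<open>n\<close> without touching binomial
  coefficients.\<close>

lemma bern_sum_Suc:
  "bern_sum (Suc n) x \<phi> = bern_sum n x (\<lambda>k. x * \<phi> (Suc k) + (1 - x) * \<phi> k)"
proof -
  have "bern_sum (Suc n) x \<phi> = \<phi> 0 * bern (Suc n) 0 x + (\<Sum>k\<le>n. \<phi> (Suc k) * bern (Suc n) (Suc k) x)"
    unfolding bern_sum_def by (subst sum.atMost_Suc_shift) simp
  also have "(\<Sum>k\<le>n. \<phi> (Suc k) * bern (Suc n) (Suc k) x)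
      = (\<Sum>k\<le>n. x * \<phi> (Suc k) * bern n k x) + (\<Sum>k\<le>n. (1 - x) * \<phi> (Suc k) * bern n (Suc k) x)"
    unfolding sum.distrib[symmetric] by (rule sum.cong) (simp_all add: bern_Suc algebra_simps)
  also have "\<phi> 0 * bern (Suc n) 0 x = (1 - x) * \<phi> 0 * bern n 0 x"
    by (simp add: bern_def)
  also have "(\<Sum>k\<le>n. (1 - x) * \<phi> (Suc k) * bern n (Suc k) x)
      = (\<Sum>k\<le>Suc n. (1 - x) * \<phi> k * bern n k x) - (1 - x) * \<phi> 0 * bern n 0 x"
    by (subst sum.atMost_Suc_shift) simp
  also have "(\<Sum>k\<le>Suc n. (1 - x) * \<phi> k * bern n k x) = (\<Sum>k\<le>n. (1 - x) * \<phi> k * bern n k x)"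
    by (simp add: bern_def)
  finally show ?thesis
    by (simp add: bern_sum_def sum.distrib[symmetric] distrib_right)
qed

lemma bern_sum_linear:
  "bern_sum n x (\<lambda>k. \<phi> k + \<psi> k) = bern_sum n x \<phi> + bern_sum n x \<psi>"
  "bern_sum n x (\<lambda>k. c * \<phi> k) = c * bern_sum n x \<phi>"
  "bern_sum n x (\<lambda>k. \<phi> k * c) = bern_sum n x \<phi> * c"
  by (simp_all add: bern_sum_def sum.distrib sum_distrib_left sum_distrib_right algebra_simps)

lemma bern_sum_const: "bern_sum n x (\<lambda>k. c) = c"
proof (induction n)
  case 0
  show ?case by (simp add: bern_sum_def bern_def)
next
  case (Suc n)
  then show ?case by (simp add: bern_sum_Suc algebra_simps)
qed

text \<open>The recursion in \<open>n\<close> for one power involves all lower powers, so the four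
  formulas are proved in a single induction. The right-hand sides are combinations of factorial
  moments, with Stirling numbers of the second kind as coefficients.\<close>

lemma bern_sum_powers:
  fixes n :: nat and x :: real
  defines "N \<equiv> real n"
  shows "bern_sum n x (\<lambda>k. real k) = N * x"
    and "bern_sum n x (\<lambda>k. real k ^ 2) = N * x + N * (N - 1) * x ^ 2"
    and "bern_sum n x (\<lambda>k. real k ^ 3) = N * x + 3 * N * (N - 1) * x ^ 2 + N * (N - 1) * (N - 2) * x ^ 3"
    and "bern_sum n x (\<lambda>k. real k ^ 4) = N * x + 7 * N * (N - 1) * x ^ 2
      + 6 * N * (N - 1) * (N - 2) * x ^ 3 + N * (N - 1) * (N - 2) * (N - 3) * x ^ 4"
proof -
  have "bern_sum n x (\<lambda>k. real k) = real n * x \<and>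
    bern_sum n x (\<lambda>k. real k ^ 2) = real n * x + real n * (real n - 1) * x ^ 2 \<and>
    bern_sum n x (\<lambda>k. real k ^ 3) = real n * x + 3 * real n * (real n - 1) * x ^ 2
      + real n * (real n - 1) * (real n - 2) * x ^ 3 \<and>
    bern_sum n x (\<lambda>k. real k ^ 4) = real n * x + 7 * real n * (real n - 1) * x ^ 2
      + 6 * real n * (real n - 1) * (real n - 2) * x ^ 3
      + real n * (real n - 1) * (real n - 2) * (real n - 3) * x ^ 4"
    (is "?A n \<and> ?B n \<and> ?C n \<and> ?D n")
  proof (induction n)
    case 0
    show ?case by (simp add: bern_sum_def bern_def)
  next
    case (Suc n)
    note IH = Suc.IH[THEN conjunct1] Suc.IH[THEN conjunct2, THEN conjunct1]
      Suc.IH[THEN conjunct2, THEN conjunct2, THEN conjunct1]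
      Suc.IH[THEN conjunct2, THEN conjunct2, THEN conjunct2]
    have 1: "(\<lambda>k. x * real (Suc k) + (1 - x) * real k) = (\<lambda>k. x + real k)"
      and 2: "(\<lambda>k. x * real (Suc k) ^ 2 + (1 - x) * real k ^ 2) = (\<lambda>k. (x + 2 * x * real k) + real k ^ 2)"
      and 3: "(\<lambda>k. x * real (Suc k) ^ 3 + (1 - x) * real k ^ 3)
        = (\<lambda>k. ((x + 3 * x * real k) + 3 * x * real k ^ 2) + real k ^ 3)"
      and 4: "(\<lambda>k. x * real (Suc k) ^ 4 + (1 - x) * real k ^ 4)
        = (\<lambda>k. (((x + 4 * x * real k) + 6 * x * real k ^ 2) + 4 * x * real k ^ 3) + real k ^ 4)"
      by (auto simp: fun_eq_iff algebra_simps eval_nat_numeral)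
    have "?A (Suc n)"
      unfolding bern_sum_Suc 1 bern_sum_linear bern_sum_const IH by (simp add: algebra_simps)
    moreover have "?B (Suc n)"
      unfolding bern_sum_Suc 2 bern_sum_linear bern_sum_const IH
      by (simp add: algebra_simps eval_nat_numeral)
    moreover have "?C (Suc n)"
      unfolding bern_sum_Suc 3 bern_sum_linear bern_sum_const IH
      by (simp add: algebra_simps eval_nat_numeral)
    moreover have "?D (Suc n)"
      unfolding bern_sum_Suc 4 bern_sum_linear bern_sum_const IH
      by (simp add: algebra_simps eval_nat_numeral)
    ultimately show ?case by blast
  qed
  then show "bern_sum n x (\<lambda>k. real k) = N * x"
    and "bern_sum n x (\<lambda>k. real k ^ 2) = N * x + N * (N - 1) * x ^ 2"
    and "bern_sum n x (\<lambda>k. real k ^ 3) = N * x + 3 * N * (N - 1) * x ^ 2 + N * (N - 1) * (N - 2) * x ^ 3"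
    and "bern_sum n x (\<lambda>k. real k ^ 4) = N * x + 7 * N * (N - 1) * x ^ 2
      + 6 * N * (N - 1) * (N - 2) * x ^ 3 + N * (N - 1) * (N - 2) * (N - 3) * x ^ 4"
    unfolding N_def by blast+
qed

section \<open>Beta integrals and integrability against the weights\<close>

lemma Beta_plus_nat:
  fixes a b :: real
  assumes "a > 0" "b > 0"
  shows "Beta (a + real i) b = pochhammer a i / pochhammer (a + b) i * Beta a b"
proof (induction i)
  case (Suc i)
  have "a + real i \<notin> \<int>\<^sub>\<le>\<^sub>0" using assms by (auto elim!: nonpos_Ints_cases)
  from Beta_plus1_left[OF this, of b]
  have "(a + b + real i) * Beta (a + real (Suc i)) b = (a + real i) * Beta (a + real i) b"
    by (simp add: algebra_simps)
  moreover have "a + b + real i > 0" using assms by auto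
  ultimately have "Beta (a + real (Suc i)) b = (a + real i) / (a + b + real i) * Beta (a + real i) b"
    by (simp add: field_simps)
  then show ?case by (simp add: Suc.IH pochhammer_Suc mult_ac)
qed simp

text \<open>Under the beta density the factor \<open>t ^ i\<close> merely raises the first parameter
  by \<open>i\<close>, so the moment is a quotient of two Beta values.\<close>

lemma has_integral_power_mu:
  assumes "\<rho> > 0" "1 \<le> k" "k \<le> n - 1"
  shows "((\<lambda>t. t ^ i * mu \<rho> n k t) has_integral
    pochhammer (real k * \<rho>) i / pochhammer (real n * \<rho>) i) {0..1}"
proof -
  define a b where "a = real k * \<rho>" and "b = real (n - k) * \<rho>"
  have ab: "a > 0" "b > 0" using assms by (auto simp: a_def b_def)
  have s: "a + b = real n * \<rho>" using assms by (simp add: a_def b_def of_nat_diff algebra_simps)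
  have B: "Beta a b > 0" using ab by (simp add: Beta_def Gamma_real_pos)
  have "((\<lambda>t. t powr (a + real i - 1) * (1 - t) powr (b - 1) * (1 / Beta a b)) has_integral
      Beta (a + real i) b * (1 / Beta a b)) {0..1}"
    using ab by (intro has_integral_mult_left has_integral_Beta_real) auto
  then have "((\<lambda>t. t ^ i * mu \<rho> n k t) has_integral Beta (a + real i) b * (1 / Beta a b)) {0..1}"
  proof (rule has_integral_eq[rotated])
    fix t :: real assume t: "t \<in> {0..1}"
    have "t ^ i * t powr (a - 1) = t powr (a + real i - 1)"
    \<comment> \<open>At \<open>t = 0\<close> every \<open>powr\<close> is 0 by convention while
      \<open>t ^ 0\<close> is 1, so this endpoint is checked apart from the exponent law.\<close>
    proof (cases "t = 0 \<and> i = 0")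
      case False
      then show ?thesis using t
        by (cases "t = 0") (auto simp: powr_realpow[symmetric] powr_add[symmetric] algebra_simps)
    qed auto
    then show "t powr (a + real i - 1) * (1 - t) powr (b - 1) * (1 / Beta a b) = t ^ i * mu \<rho> n k t"
      by (simp add: mu_def a_def[symmetric] b_def[symmetric] mult.assoc[symmetric])
  qed
  moreover have "Beta (a + real i) b * (1 / Beta a b) = pochhammer a i / pochhammer (a + b) i"
    using B by (simp add: Beta_plus_nat[OF ab])
  ultimately have "((\<lambda>t. t ^ i * mu \<rho> n k t) has_integral pochhammer a i / pochhammer (a + b) i) {0..1}"
    by simp
  then show ?thesis unfolding s by (simp add: a_def)
qed

lemma mu_nonneg: "\<rho> > 0 \<Longrightarrow> 1 \<le> k \<Longrightarrow> k \<le> n - 1 \<Longrightarrow> mu \<rho> n k t \<ge> 0"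
  by (auto simp: mu_def Beta_def simp del: of_nat_diff
      intro!: divide_nonneg_nonneg mult_nonneg_nonneg Gamma_real_nonneg add_pos_nonneg)

lemma integrable_mult_mu:
  assumes "\<rho> > 0" "1 \<le> k" "k \<le> n - 1" "continuous_on {0..1} f"
  shows "(\<lambda>t. f t * mu \<rho> n k t) integrable_on {0..1}"
proof -
  have "mu \<rho> n k integrable_on {0..1}"
    using has_integral_power_mu[OF assms(1-3), of 0] by (auto simp: integrable_on_def)
  then have "mu \<rho> n k absolutely_integrable_on {0..1}"
    by (rule nonnegative_absolutely_integrable_1) (use assms mu_nonneg in auto)
  moreover have "f \<in> borel_measurable (lebesgue_on {0..1})"
    using assms(4) by (intro continuous_imp_measurable_on_sets_lebesgue) auto
  moreover have "bounded (f ` {0..1})"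
    using assms(4) by (intro compact_imp_bounded compact_continuous_image) auto
  ultimately have "(\<lambda>t. f t * mu \<rho> n k t) absolutely_integrable_on {0..1}"
    by (intro absolutely_integrable_bounded_measurable_product_real) auto
  then show ?thesis by (rule set_lebesgue_integral_eq_integral(1))
qed


section \<open>Linearity, positivity and moments of the operator\<close>

lemma paltanea_eq_bern_sum:
  assumes "n \<ge> 1" "\<phi> 0 = f 0" "\<phi> n = f 1"
    and "\<And>k. 1 \<le> k \<Longrightarrow> k \<le> n - 1 \<Longrightarrow> integral {0..1} (\<lambda>t. f t * mu \<rho> n k t) = \<phi> k"
  shows "paltanea \<rho> n f x = bern_sum n x \<phi>"
proof -
  have "{..n} = insert 0 (insert n {1..n - 1})" using assms(1) by auto
  then have "bern_sum n x \<phi> = \<phi> 0 * bern n 0 x + (\<phi> n * bern n n x + (\<Sum>k = 1..n - 1. \<phi> k * bern n k x))"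
    using assms(1) by (simp add: bern_sum_def)
  moreover have "(\<Sum>k = 1..n - 1. integral {0..1} (\<lambda>t. f t * mu \<rho> n k t) * bern n k x)
      = (\<Sum>k = 1..n - 1. \<phi> k * bern n k x)"
    using assms(4) by (intro sum.cong) auto
  ultimately show ?thesis using assms(2,3) by (simp add: paltanea_def bern_def)
qed

text \<open>The formula for the inner weights also yields the endpoint values: at
  \<open>k = 0\<close> it gives \<open>0 ^ i\<close>, at \<open>k = n\<close> it gives 1. Hence the
  two boundary terms join the sum and the binomial moments apply.\<close>

lemma paltanea_power:
  assumes "\<rho> > 0" "n \<ge> 1"
  shows "paltanea \<rho> n (\<lambda>t. t ^ i) x
    = bern_sum n x (\<lambda>k. pochhammer (real k * \<rho>) i) / pochhammer (real n * \<rho>) i"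
proof -
  have "pochhammer (real n * \<rho>) i > 0" using assms by (intro pochhammer_pos) auto
  then have "paltanea \<rho> n (\<lambda>t. t ^ i) x
      = bern_sum n x (\<lambda>k. pochhammer (real k * \<rho>) i * inverse (pochhammer (real n * \<rho>) i))"
    using assms has_integral_power_mu[OF assms(1)]
    by (intro paltanea_eq_bern_sum) (auto simp: power_0_left pochhammer_0_left divide_inverse integral_unique)
  then show ?thesis by (simp add: bern_sum_linear divide_inverse)
qed

lemma paltanea_add:
  assumes "\<rho> > 0" "continuous_on {0..1} f" "continuous_on {0..1} g"
  shows "paltanea \<rho> n (\<lambda>t. f t + g t) x = paltanea \<rho> n f x + paltanea \<rho> n g x"
proof -
  have "integral {0..1} (\<lambda>t. (f t + g t) * mu \<rho> n k t)
      = integral {0..1} (\<lambda>t. f t * mu \<rho> n k t) + integral {0..1} (\<lambda>t. g t * mu \<rho> n k t)"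
    if "k \<in> {1..n - 1}" for k
    using that assms by (subst Henstock_Kurzweil_Integration.integral_add[symmetric])
      (auto intro!: integrable_mult_mu simp: distrib_right)
  then show ?thesis by (simp add: paltanea_def sum.distrib distrib_right)
qed

lemma paltanea_cmult: "paltanea \<rho> n (\<lambda>t. c * f t) x = c * paltanea \<rho> n f x"
  by (simp add: paltanea_def sum_distrib_left mult.assoc algebra_simps)

lemma paltanea_mono:
  assumes "\<rho> > 0" "x \<in> {0..1}" "continuous_on {0..1} f" "continuous_on {0..1} g"
    and "\<And>t. t \<in> {0..1} \<Longrightarrow> f t \<le> g t"
  shows "paltanea \<rho> n f x \<le> paltanea \<rho> n g x"
proof -
  have "integral {0..1} (\<lambda>t. f t * mu \<rho> n k t) * bern n k x
      \<le> integral {0..1} (\<lambda>t. g t * mu \<rho> n k t) * bern n k x" if "k \<in> {1..n - 1}" for k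
    using that assms
    by (intro mult_right_mono integral_le integrable_mult_mu mu_nonneg) (auto simp: bern_def)
  then show ?thesis using assms
    unfolding paltanea_def by (intro add_mono sum_mono) (auto intro!: mult_right_mono)
qed

text \<open>The last three left-hand sides are binomial expansions of central moments. Each closed
  form contains the variance as a factor, which is where the factor \<open>x * (1 - x)\<close> of
  the final estimate comes from.\<close>

lemma paltanea_moments:
  fixes x \<rho> :: real
  assumes "\<rho> > 0" "n \<ge> 1"
  defines "N \<equiv> real n * \<rho>"
  defines "e \<equiv> \<lambda>i. paltanea \<rho> n (\<lambda>t. t ^ i) x"
  shows "e 0 = 1" "e 1 = x"
    and "e 2 - 2 * x * e 1 + x\<^sup>2 = x * (1 - x) * (\<rho> + 1) / (N + 1)"
    and "e 3 - 3 * x * e 2 + 3 * x\<^sup>2 * e 1 - x ^ 3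
      = x * (1 - x) * (1 - 2 * x) * (\<rho> + 1) * (\<rho> + 2) / ((N + 1) * (N + 2))"
    and "e 4 - 4 * x * e 3 + 6 * x\<^sup>2 * e 2 - 4 * x ^ 3 * e 1 + x ^ 4
      = x * (1 - x) * (\<rho> + 1) * ((\<rho> + 2) * (\<rho> + 3)
          + x * (1 - x) * (3 * (\<rho> + 1) * N - 6 * (\<rho>\<^sup>2 + 3 * \<rho> + 3)))
        / ((N + 1) * (N + 2) * (N + 3))"
proof -
  have N: "N > 0" using assms by (simp add: N_def)
  define v where "v = real n"
  have Nv: "N = v * \<rho>" and v: "v > 0" using assms by (auto simp: N_def v_def)
  note E = bern_sum_powers[of n x, folded v_def]
  show e0: "e 0 = 1" by (simp add: e_def paltanea_power[OF assms(1,2)] bern_sum_const)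
  have "e 1 = \<rho> * (v * x) / N"
    by (simp add: e_def paltanea_power[OF assms(1,2), folded N_def] bern_sum_linear E)
  then show e1: "e 1 = x" using N v assms(1) by (simp add: Nv)
  have p2: "pochhammer y 2 = y * (y + 1)" and p3: "pochhammer y 3 = y * (y + 1) * (y + 2)"
    and p4: "pochhammer y 4 = y * (y + 1) * (y + 2) * (y + 3)" for y :: real
    by (simp_all add: eval_nat_numeral pochhammer_Suc algebra_simps)
  \<comment> \<open>Rising factorials are expanded in powers, with unsigned Stirling numbers of the
    first kind as coefficients, to reach the binomial power moments.\<close>
  have 2: "(\<lambda>k. pochhammer (real k * \<rho>) 2) = (\<lambda>k. \<rho> * real k + \<rho>\<^sup>2 * real k ^ 2)"
    and 3: "(\<lambda>k. pochhammer (real k * \<rho>) 3)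
      = (\<lambda>k. (2 * \<rho> * real k + 3 * \<rho>\<^sup>2 * real k ^ 2) + \<rho> ^ 3 * real k ^ 3)"
    and 4: "(\<lambda>k. pochhammer (real k * \<rho>) 4)
      = (\<lambda>k. ((6 * \<rho> * real k + 11 * \<rho>\<^sup>2 * real k ^ 2) + 6 * \<rho> ^ 3 * real k ^ 3) + \<rho> ^ 4 * real k ^ 4)"
    unfolding p2 p3 p4 by (auto simp: fun_eq_iff algebra_simps eval_nat_numeral)
  define Q where "Q = (N + 1) * (N + 2) * (N + 3)"
  have pos: "v * \<rho> > 0" "v * \<rho> + 1 > 0" "v * \<rho> + 2 > 0" "v * \<rho> + 3 > 0" using N Nv by auto
  \<comment> \<open>\<open>P2\<close>, \<open>P3\<close>, \<open>P4\<close> are the numerators of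
    the moments after cancelling the factor \<open>v * \<rho>\<close> that they share with the
    denominators.\<close>
  define P2 where "P2 = x + \<rho> * (x + (v - 1) * x\<^sup>2)"
  define P3 where "P3 = 2 * x + 3 * \<rho> * (x + (v - 1) * x\<^sup>2)
    + \<rho>\<^sup>2 * (x + 3 * (v - 1) * x\<^sup>2 + (v - 1) * (v - 2) * x ^ 3)"
  define P4 where "P4 = 6 * x + 11 * \<rho> * (x + (v - 1) * x\<^sup>2)
    + 6 * \<rho>\<^sup>2 * (x + 3 * (v - 1) * x\<^sup>2 + (v - 1) * (v - 2) * x ^ 3)
    + \<rho> ^ 3 * (x + 7 * (v - 1) * x\<^sup>2 + 6 * (v - 1) * (v - 2) * x ^ 3
        + (v - 1) * (v - 2) * (v - 3) * x ^ 4)"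
  have "e 2 = (v * \<rho> * P2) / (v * \<rho> * (N + 1))"
    unfolding e_def paltanea_power[OF assms(1,2), folded N_def] 2 bern_sum_linear E unfolding p2 Nv P2_def
    by (rule arg_cong2[where f="(/)"]) (simp_all add: algebra_simps eval_nat_numeral)
  then have e2: "e 2 * (N + 1) = P2" using N v assms(1) by simp
  have "e 3 = (v * \<rho> * P3) / (v * \<rho> * ((N + 1) * (N + 2)))"
    unfolding e_def paltanea_power[OF assms(1,2), folded N_def] 3 bern_sum_linear E unfolding p3 Nv P3_def
    by (rule arg_cong2[where f="(/)"]) (simp_all add: algebra_simps eval_nat_numeral)
  then have e3: "e 3 * ((N + 1) * (N + 2)) = P3" using N v assms(1) by simp
  have "e 4 = (v * \<rho> * P4) / (v * \<rho> * Q)"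
    unfolding e_def paltanea_power[OF assms(1,2), folded N_def] 4 bern_sum_linear E unfolding p4 Nv P4_def Q_def
    by (rule arg_cong2[where f="(/)"]) (simp_all add: algebra_simps eval_nat_numeral)
  then have e4: "e 4 * Q = P4" using N v assms(1) by (simp add: Q_def)
  \<comment> \<open>Here and below the central moment is multiplied by its denominator, which leaves
    a polynomial identity in \<open>x\<close>, \<open>v\<close> and \<open>\<rho>\<close>.\<close>
  have "(e 2 - 2 * x * e 1 + x\<^sup>2) * (N + 1) = e 2 * (N + 1) - x\<^sup>2 * (N + 1)"
    unfolding e1 by (simp add: algebra_simps power2_eq_square)
  also have "\<dots> = x * (1 - x) * (\<rho> + 1)"
    unfolding e2 unfolding P2_def Nv by (simp add: algebra_simps power2_eq_square)
  finally show "e 2 - 2 * x * e 1 + x\<^sup>2 = x * (1 - x) * (\<rho> + 1) / (N + 1)"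
    using N by (simp add: eq_divide_eq)
  have "(e 3 - 3 * x * e 2 + 3 * x\<^sup>2 * e 1 - x ^ 3) * ((N + 1) * (N + 2))
      = e 3 * ((N + 1) * (N + 2)) - 3 * x * (e 2 * (N + 1)) * (N + 2) + 2 * x ^ 3 * ((N + 1) * (N + 2))"
    unfolding e1 by (simp add: algebra_simps eval_nat_numeral)
  also have "\<dots> = x * (1 - x) * (1 - 2 * x) * (\<rho> + 1) * (\<rho> + 2)"
    unfolding e2 e3 unfolding P2_def P3_def Nv by (simp add: algebra_simps eval_nat_numeral)
  finally show "e 3 - 3 * x * e 2 + 3 * x\<^sup>2 * e 1 - x ^ 3
      = x * (1 - x) * (1 - 2 * x) * (\<rho> + 1) * (\<rho> + 2) / ((N + 1) * (N + 2))"
    using N by (simp add: eq_divide_eq)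
  have "(e 4 - 4 * x * e 3 + 6 * x\<^sup>2 * e 2 - 4 * x ^ 3 * e 1 + x ^ 4) * Q
      = e 4 * Q - 4 * x * (e 3 * ((N + 1) * (N + 2))) * (N + 3)
        + 6 * x\<^sup>2 * (e 2 * (N + 1)) * ((N + 2) * (N + 3)) - 3 * x ^ 4 * Q"
    unfolding e1 Q_def by algebra
  also have "\<dots> = x * (1 - x) * (\<rho> + 1) * ((\<rho> + 2) * (\<rho> + 3)
          + x * (1 - x) * (3 * (\<rho> + 1) * N - 6 * (\<rho>\<^sup>2 + 3 * \<rho> + 3)))"
    unfolding e2 e3 e4 unfolding P2_def P3_def P4_def Nv Q_def by algebra
  finally show "e 4 - 4 * x * e 3 + 6 * x\<^sup>2 * e 2 - 4 * x ^ 3 * e 1 + x ^ 4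
      = x * (1 - x) * (\<rho> + 1) * ((\<rho> + 2) * (\<rho> + 3)
          + x * (1 - x) * (3 * (\<rho> + 1) * N - 6 * (\<rho>\<^sup>2 + 3 * \<rho> + 3)))
        / ((N + 1) * (N + 2) * (N + 3))"
    using N by (simp add: eq_divide_eq Q_def)
qed

section \<open>Covariance of a positive mean\<close>

text \<open>This isolates what the covariance estimate uses of the operator at a fixed point: a
  positive normalised linear functional with mean \<open>x\<close>, where \<open>d\<close> stands
  for \<open>\<delta>\<close>. The constants 2 and 5 in the higher moments are absolute, which makes
  the final constant independent of \<open>\<rho>\<close>.\<close>

locale mean_functional =
  fixes L :: "(real \<Rightarrow> real) \<Rightarrow> real" and x d :: real
  assumes x: "x \<in> {0..1}" and d: "0 < d" "d \<le> 1"
    and add: "continuous_on {0..1} f \<Longrightarrow> continuous_on {0..1} g \<Longrightarrow> L (\<lambda>t. f t + g t) = L f + L g"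
    and cmult: "L (\<lambda>t. c * f t) = c * L f"
    and mono: "continuous_on {0..1} f \<Longrightarrow> continuous_on {0..1} g \<Longrightarrow>
      (\<And>t. t \<in> {0..1} \<Longrightarrow> f t \<le> g t) \<Longrightarrow> L f \<le> L g"
    and one: "L (\<lambda>t. 1) = 1"
    and moment1: "L (\<lambda>t. t - x) = 0"
    and moment2: "L (\<lambda>t. (t - x)\<^sup>2) = x * (1 - x) * d"
    and moment3: "\<bar>L (\<lambda>t. (t - x) ^ 3)\<bar> \<le> 2 * (x * (1 - x) * d\<^sup>2)"
    and moment4: "L (\<lambda>t. (t - x) ^ 4) \<le> 5 * (x * (1 - x) * d\<^sup>2)"
begin

lemma const: "L (\<lambda>t. c) = c"
  using cmult[of c "\<lambda>t. 1"] one by simp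

lemma diff:
  assumes "continuous_on {0..1} f" "continuous_on {0..1} g"
  shows "L (\<lambda>t. f t - g t) = L f - L g"
  using add[OF assms(1) continuous_on_mult[OF continuous_on_const[of _ "-1"] assms(2)]] cmult[of "-1" g]
  by simp

lemma abs_le:
  assumes "continuous_on {0..1} f" "continuous_on {0..1} g"
    and "\<And>t. t \<in> {0..1} \<Longrightarrow> \<bar>f t\<bar> \<le> g t"
  shows "\<bar>L f\<bar> \<le> L g"
proof -
  have "L f \<le> L g" using assms by (intro mono) (auto simp: abs_le_iff)
  moreover have "L (\<lambda>t. (-1) * g t) \<le> L f" using assms
    by (intro mono continuous_intros) (fastforce simp: abs_le_iff)+
  ultimately show ?thesis unfolding cmult by simp
qed

text \<open>This is the Cauchy-Schwarz inequality, obtained from the nonnegative variance of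
  \<open>\<bar>t - x\<bar>\<close> around its own mean \<open>c\<close>.\<close>

lemma abs_moment1: "L (\<lambda>t. \<bar>t - x\<bar>) \<le> sqrt (x * (1 - x) * d)"
proof (rule real_le_rsqrt)
  define c where "c = L (\<lambda>t. \<bar>t - x\<bar>)"
  have "0 \<le> L (\<lambda>t. (\<bar>t - x\<bar> - c)\<^sup>2)"
    by (subst const[of 0, symmetric], intro mono continuous_intros) auto
  also have "(\<lambda>t. (\<bar>t - x\<bar> - c)\<^sup>2) = (\<lambda>t. ((t - x)\<^sup>2 - 2 * c * \<bar>t - x\<bar>) + c\<^sup>2)"
    by (auto simp: fun_eq_iff power2_diff abs_mult_self_eq power2_eq_square algebra_simps)
  also have "L \<dots> = L (\<lambda>t. (t - x)\<^sup>2) - 2 * c * c + c\<^sup>2"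
    by (subst add, intro continuous_intros, intro continuous_intros,
        subst diff, intro continuous_intros, intro continuous_intros) (simp only: cmult const c_def)
  finally show "(L (\<lambda>t. \<bar>t - x\<bar>))\<^sup>2 \<le> x * (1 - x) * d"
    unfolding moment2 c_def by (simp add: power2_eq_square)
qed

text \<open>The third power is interpolated between the second and the fourth. The weight
  \<open>q = sqrt d\<close> balances the moments of order \<open>d\<close> and \<open>d^2\<close>,
  and \<open>1/2 + 5/2\<close> gives the constant 3.\<close>

lemma abs_moment3:
  "L (\<lambda>t. \<bar>t - x\<bar> ^ 3) \<le> 3 * (x * (1 - x) * d * sqrt d)"
proof -
  define q where "q = sqrt d"
  have q: "q > 0" "q\<^sup>2 = d" using d by (auto simp: q_def)
  have "\<bar>t\<bar> ^ 3 \<le> q / 2 * t\<^sup>2 + 1 / (2 * q) * t ^ 4" for t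
  proof -
    have "0 \<le> t\<^sup>2 * (q - \<bar>t\<bar>)\<^sup>2" by simp
    then have "2 * q * \<bar>t\<bar> ^ 3 \<le> q\<^sup>2 * t\<^sup>2 + t ^ 4"
      by (cases "t \<ge> 0") (simp_all add: power2_diff algebra_simps eval_nat_numeral)
    then show ?thesis using q(1) by (simp add: field_simps power2_eq_square)
  qed
  then have "L (\<lambda>t. \<bar>t - x\<bar> ^ 3) \<le> L (\<lambda>t. q / 2 * (t - x)\<^sup>2 + 1 / (2 * q) * (t - x) ^ 4)"
    by (intro mono continuous_intros) auto
  also have "\<dots> = q / 2 * (x * (1 - x) * d) + 1 / (2 * q) * L (\<lambda>t. (t - x) ^ 4)"
    by (subst add, intro continuous_intros, intro continuous_intros) (simp only: cmult moment2)
  also have "\<dots> \<le> q / 2 * (x * (1 - x) * d) + 1 / (2 * q) * (5 * (x * (1 - x) * d\<^sup>2))"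
    using moment4 q by (intro add_left_mono mult_left_mono) auto
  also have "\<dots> = 3 * (x * (1 - x) * d * q)"
    using q by (simp add: q(2)[symmetric] field_simps power2_eq_square)
  finally show ?thesis by (simp add: q_def)
qed

text \<open>The vanishing first central moment removes the linear term, whatever its coefficient, so
  only the quadratic term and the remainder count. A product of two such deviations is of order
  \<open>M M'\<close> times the variance, as the covariance estimate requires.\<close>

lemma quadratic_expansion:
  assumes f: "continuous_on {0..1} f" and K: "K \<ge> 0" and w: "0 \<le> w" "w \<le> M"
    and M: "M = sqrt d * N" and a: "\<bar>a\<^sub>2\<bar> \<le> K * N"
    and R: "\<And>t. t \<in> {0..1} \<Longrightarrow>
      \<bar>f t - f x - a\<^sub>1 * (t - x) - a\<^sub>2 * (t - x)\<^sup>2\<bar> \<le> K * (w * \<bar>t - x\<bar> + N * \<bar>t - x\<bar> ^ 3)"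
  shows "\<bar>L f - f x\<bar> \<le> 5 * K * M * sqrt (x * (1 - x) * d)"
proof -
  define X where "X = x * (1 - x)"
  define q where "q = sqrt d"
  define r where "r = sqrt X"
  define R where "R = (\<lambda>t. f t - f x - a\<^sub>1 * (t - x) - a\<^sub>2 * (t - x)\<^sup>2)"
  have X: "0 \<le> X" "X \<le> 1" using x unfolding X_def by (auto intro: mult_le_one)
  have q: "q > 0" "q\<^sup>2 = d" "q \<le> 1" using d by (auto simp: q_def)
  have qq: "q * q = d" using q(2) by (simp add: power2_eq_square)
  have Mq: "M = q * N" by (simp add: M q_def)
  have r: "0 \<le> r" "r\<^sup>2 = X" "r \<le> 1" using X by (auto simp: r_def)
  have "0 \<le> q * N" using M w by (simp add: q_def)
  then have N: "N \<ge> 0" using q(1) by (simp add: zero_le_mult_iff)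
  have cR: "continuous_on {0..1} R" unfolding R_def using f by (intro continuous_intros)
  have "\<bar>L R\<bar> \<le> L (\<lambda>t. K * w * \<bar>t - x\<bar> + K * N * \<bar>t - x\<bar> ^ 3)"
    using assms(7) by (intro abs_le cR continuous_intros) (auto simp: R_def algebra_simps)
  also have "\<dots> = K * w * L (\<lambda>t. \<bar>t - x\<bar>) + K * N * L (\<lambda>t. \<bar>t - x\<bar> ^ 3)"
    by (subst add, intro continuous_intros, intro continuous_intros) (simp only: cmult)
  also have "\<dots> \<le> K * w * (r * q) + K * N * (3 * (X * d * q))"
    using abs_moment1 abs_moment3 K w N
    by (intro add_mono mult_left_mono) (auto simp: X_def q_def r_def real_sqrt_mult)
  finally have LR: "\<bar>L R\<bar> \<le> K * w * (r * q) + K * N * (3 * (X * d * q))" .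
  have "f = (\<lambda>t. ((f x + a\<^sub>1 * (t - x)) + a\<^sub>2 * (t - x)\<^sup>2) + R t)"
    by (auto simp: R_def)
  then have "L f = L (\<lambda>t. ((f x + a\<^sub>1 * (t - x)) + a\<^sub>2 * (t - x)\<^sup>2) + R t)" by simp
  also have "\<dots> = f x + a\<^sub>2 * (X * d) + L R"
    using cR by (subst add, intro continuous_intros, assumption, subst add, intro continuous_intros, intro continuous_intros,
      subst add, intro continuous_intros, intro continuous_intros) (simp only: cmult const moment1 moment2 X_def)
  finally have "\<bar>L f - f x\<bar> \<le> \<bar>a\<^sub>2\<bar> * (X * d) + \<bar>L R\<bar>"
    using X d by (simp add: abs_mult[symmetric] abs_triangle_ineq order_trans[OF abs_triangle_ineq] abs_mult)
  also have "\<dots> \<le> K * N * (X * d) + (K * w * (r * q) + K * N * (3 * (X * d * q)))"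
    using LR a X d by (intro add_mono mult_right_mono) auto
  \<comment> \<open>Once \<open>w\<close> is bounded by \<open>M\<close>, every term contains
    \<open>K * M * (r * q)\<close>. The leftover factors \<open>r\<close> and \<open>r * q\<close>
    are at most 1, so the constants 1, 1 and 3 add up to 5.\<close>
  also have "K * N * (X * d) = (K * M * (r * q)) * r"
    by (simp add: Mq qq[symmetric] r(2)[symmetric] power2_eq_square)
  also have "K * N * (3 * (X * d * q)) = 3 * ((K * M * (r * q)) * (r * q))"
    by (simp add: Mq qq[symmetric] r(2)[symmetric] power2_eq_square)
  also have "(K * M * (r * q)) * r + (K * w * (r * q) + 3 * ((K * M * (r * q)) * (r * q)))
      \<le> (K * M * (r * q)) * 1 + (K * M * (r * q) + 3 * ((K * M * (r * q)) * 1))"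
    using K w r q by (intro add_mono mult_left_mono mult_right_mono mult_le_one) auto
  finally show ?thesis by (simp add: X_def q_def r_def real_sqrt_mult mult_ac)
qed

text \<open>In the product of the two expansions the pure powers of \<open>t - x\<close> are
  evaluated through signed moments, and only products involving a remainder, collected in
  \<open>E\<close>, are estimated pointwise. Throughout, \<open>N * N' * d = M * M'\<close> trades a
  spare factor \<open>d\<close> for the final form.\<close>

lemma covariance_expansion:
  assumes f: "continuous_on {0..1} f" and g: "continuous_on {0..1} g" and K: "K \<ge> 1"
    and w: "0 \<le> w" "w \<le> M" and w': "0 \<le> w'" "w' \<le> M'"
    and M: "M = sqrt d * N" and M': "M' = sqrt d * N'"
    and a: "\<bar>a\<^sub>1\<bar> \<le> K * N" "\<bar>a\<^sub>2\<bar> \<le> K * N" and b: "\<bar>b\<^sub>1\<bar> \<le> K * N'" "\<bar>b\<^sub>2\<bar> \<le> K * N'"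
    and R: "\<And>t. t \<in> {0..1} \<Longrightarrow>
      \<bar>f t - f x - a\<^sub>1 * (t - x) - a\<^sub>2 * (t - x)\<^sup>2\<bar> \<le> K * (w * \<bar>t - x\<bar> + N * \<bar>t - x\<bar> ^ 3)"
    and S: "\<And>t. t \<in> {0..1} \<Longrightarrow>
      \<bar>g t - g x - b\<^sub>1 * (t - x) - b\<^sub>2 * (t - x)\<^sup>2\<bar> \<le> K * (w' * \<bar>t - x\<bar> + N' * \<bar>t - x\<bar> ^ 3)"
  shows "\<bar>L (\<lambda>t. f t * g t) - L f * L g - a\<^sub>1 * b\<^sub>1 * (x * (1 - x) * d)\<bar>
    \<le> 80 * K\<^sup>2 * (x * (1 - x) * d) * (w * w' + \<bar>a\<^sub>1\<bar> * w' + \<bar>b\<^sub>1\<bar> * w + M * M')"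
proof -
  define X where "X = x * (1 - x)"
  define q where "q = sqrt d"
  define R where "R = (\<lambda>t. f t - f x - a\<^sub>1 * (t - x) - a\<^sub>2 * (t - x)\<^sup>2)"
  define S where "S = (\<lambda>t. g t - g x - b\<^sub>1 * (t - x) - b\<^sub>2 * (t - x)\<^sup>2)"
  define \<alpha> where "\<alpha> = K\<^sup>2 * (w * w' + \<bar>a\<^sub>1\<bar> * w' + \<bar>b\<^sub>1\<bar> * w + M * M')"
  \<comment> \<open>The factor 8 is the sum of the coefficients 1, 1, 3/2, 3/2, 3 of the fourth
    power in the five product estimates below.\<close>
  define \<beta> where "\<beta> = 8 * K\<^sup>2 * (N * N')"
  define E where "E = (\<lambda>t. (f t - f x) * (g t - g x) - a\<^sub>1 * b\<^sub>1 * (t - x)\<^sup>2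
    - (a\<^sub>1 * b\<^sub>2 + a\<^sub>2 * b\<^sub>1) * (t - x) ^ 3 - a\<^sub>2 * b\<^sub>2 * (t - x) ^ 4)"
  have X: "0 \<le> X" using x unfolding X_def by auto
  have q: "q > 0" "q\<^sup>2 = d" "q \<le> 1" using d by (auto simp: q_def)
  have qq: "q * q = d" using q(2) by (simp add: power2_eq_square)
  have "0 \<le> q * N" "0 \<le> q * N'" using M M' w w' by (simp_all add: q_def)
  then have N: "N \<ge> 0" "N' \<ge> 0" using q(1) by (simp_all add: zero_le_mult_iff)
  have MN: "M \<le> N" "M' \<le> N'" using N q M M' by (simp_all add: q_def[symmetric] mult_left_le_one_le)
  have K2: "K \<le> K\<^sup>2" "1 \<le> K\<^sup>2" using K self_le_power[of K 2] one_le_power[of K 2] by simp_all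
  have NN: "N * N' * d = M * M'" using qq[symmetric] by (simp add: M M' q_def[symmetric])
  have MM: "M * M' \<ge> 0" using w w' by simp
  have \<alpha>: "\<alpha> \<ge> 0" "\<beta> \<ge> 0" unfolding \<alpha>_def \<beta>_def using w w' N MM by auto
  have c: "continuous_on {0..1} E" unfolding E_def using f g by (intro continuous_intros)
  have E: "\<bar>E t\<bar> \<le> \<alpha> * (t - x)\<^sup>2 + \<beta> * (t - x) ^ 4" if t: "t \<in> {0..1}" for t
  proof -
    define T p where "T = t - x" and "p = \<bar>t - x\<bar>"
    have p: "0 \<le> p" "p \<le> 1" using t x by (auto simp: p_def)
    have T: "\<bar>T\<bar> = p" "T\<^sup>2 = p\<^sup>2" "T ^ 4 = p ^ 4"
      by (simp_all add: T_def p_def power_even_abs)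
    have p4: "p ^ 5 \<le> p ^ 4" "p ^ 6 \<le> p ^ 4" using p by (auto intro: power_decreasing)
    \<comment> \<open>Enlarging \<open>w'\<close> to \<open>M' = q * N'\<close> (or \<open>w\<close>
      to \<open>M = q * N\<close>) produces the odd term \<open>q * p ^ 3\<close>. It is split into
      a square and a fourth power, whose moments have the required orders.\<close>
    have p3: "q * p ^ 3 \<le> (d * p\<^sup>2 + p ^ 4) / 2"
    proof -
      have "0 \<le> p\<^sup>2 * (q - p)\<^sup>2" by simp
      then show ?thesis unfolding q(2)[symmetric] by (simp add: power2_diff algebra_simps eval_nat_numeral)
    qed
    have Rt: "\<bar>R t\<bar> \<le> K * (w * p + N * p ^ 3)" and St: "\<bar>S t\<bar> \<le> K * (w' * p + N' * p ^ 3)"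
      using assms(14,15)[OF t] by (simp_all add: R_def S_def p_def)
    have "f t - f x = a\<^sub>1 * T + a\<^sub>2 * T\<^sup>2 + R t" "g t - g x = b\<^sub>1 * T + b\<^sub>2 * T\<^sup>2 + S t"
      by (simp_all add: R_def S_def T_def)
    then have "E t = a\<^sub>1 * T * S t + b\<^sub>1 * T * R t + a\<^sub>2 * T\<^sup>2 * S t + b\<^sub>2 * T\<^sup>2 * R t + R t * S t"
      unfolding E_def T_def[symmetric] by (simp add: algebra_simps eval_nat_numeral)
    then have Et: "\<bar>E t\<bar> \<le> \<bar>a\<^sub>1 * T * S t\<bar> + \<bar>b\<^sub>1 * T * R t\<bar> + \<bar>a\<^sub>2 * T\<^sup>2 * S t\<bar> + \<bar>b\<^sub>2 * T\<^sup>2 * R t\<bar> + \<bar>R t * S t\<bar>"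
      by linarith
    have abs: "\<bar>a\<^sub>1 * T * S t\<bar> + \<bar>b\<^sub>1 * T * R t\<bar> + \<bar>a\<^sub>2 * T\<^sup>2 * S t\<bar> + \<bar>b\<^sub>2 * T\<^sup>2 * R t\<bar> + \<bar>R t * S t\<bar>
      = \<bar>a\<^sub>1\<bar> * p * \<bar>S t\<bar> + \<bar>b\<^sub>1\<bar> * p * \<bar>R t\<bar> + \<bar>a\<^sub>2\<bar> * p\<^sup>2 * \<bar>S t\<bar> + \<bar>b\<^sub>2\<bar> * p\<^sup>2 * \<bar>R t\<bar> + \<bar>R t\<bar> * \<bar>S t\<bar>"
      by (simp add: abs_mult T p_def)
    have 1: "\<bar>a\<^sub>1\<bar> * p * \<bar>S t\<bar> \<le> K\<^sup>2 * (\<bar>a\<^sub>1\<bar> * w') * p\<^sup>2 + K\<^sup>2 * (N * N') * p ^ 4"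
    proof -
      have "\<bar>a\<^sub>1\<bar> * p * \<bar>S t\<bar> \<le> \<bar>a\<^sub>1\<bar> * p * (K * (w' * p + N' * p ^ 3))"
        using St p by (intro mult_left_mono) auto
      also have "\<dots> = K * (\<bar>a\<^sub>1\<bar> * w') * p\<^sup>2 + K * N' * p ^ 4 * \<bar>a\<^sub>1\<bar>"
        by (simp add: algebra_simps eval_nat_numeral)
      also have "\<dots> \<le> K\<^sup>2 * (\<bar>a\<^sub>1\<bar> * w') * p\<^sup>2 + K * N' * p ^ 4 * (K * N)"
        using K K2 a w' N p by (intro add_mono mult_left_mono mult_right_mono) auto
      finally show ?thesis by (simp add: power2_eq_square mult_ac)
    qed
    have 2: "\<bar>b\<^sub>1\<bar> * p * \<bar>R t\<bar> \<le> K\<^sup>2 * (\<bar>b\<^sub>1\<bar> * w) * p\<^sup>2 + K\<^sup>2 * (N * N') * p ^ 4"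
    proof -
      have "\<bar>b\<^sub>1\<bar> * p * \<bar>R t\<bar> \<le> \<bar>b\<^sub>1\<bar> * p * (K * (w * p + N * p ^ 3))"
        using Rt p by (intro mult_left_mono) auto
      also have "\<dots> = K * (\<bar>b\<^sub>1\<bar> * w) * p\<^sup>2 + K * N * p ^ 4 * \<bar>b\<^sub>1\<bar>"
        by (simp add: algebra_simps eval_nat_numeral)
      also have "\<dots> \<le> K\<^sup>2 * (\<bar>b\<^sub>1\<bar> * w) * p\<^sup>2 + K * N * p ^ 4 * (K * N')"
        using K K2 b w N p by (intro add_mono mult_left_mono mult_right_mono) auto
      finally show ?thesis by (simp add: power2_eq_square mult_ac)
    qed
    have 3: "\<bar>a\<^sub>2\<bar> * p\<^sup>2 * \<bar>S t\<bar> \<le> K\<^sup>2 * (M * M') / 2 * p\<^sup>2 + K\<^sup>2 * (N * N') * (3 / 2) * p ^ 4"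
    proof -
      have "\<bar>a\<^sub>2\<bar> * p\<^sup>2 * \<bar>S t\<bar> \<le> K * N * p\<^sup>2 * (K * (M' * p + N' * p ^ 3))"
        using St p a K N w' 
        by (intro mult_mono order_trans[OF St] mult_left_mono add_mono mult_right_mono mult_nonneg_nonneg add_nonneg_nonneg) auto
      also have "\<dots> = K\<^sup>2 * (N * N') * (q * p ^ 3 + p ^ 5)"
        by (simp add: M' q_def[symmetric] algebra_simps eval_nat_numeral)
      also have "\<dots> \<le> K\<^sup>2 * (N * N') * ((d * p\<^sup>2 + p ^ 4) / 2 + p ^ 4)"
        using p3 p4 N by (intro mult_left_mono add_mono) auto
      also have "\<dots> = K\<^sup>2 * (N * N' * d) / 2 * p\<^sup>2 + K\<^sup>2 * (N * N') * (3 / 2) * p ^ 4"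
        by (simp add: field_simps)
      finally show ?thesis unfolding NN .
    qed
    have 4: "\<bar>b\<^sub>2\<bar> * p\<^sup>2 * \<bar>R t\<bar> \<le> K\<^sup>2 * (M * M') / 2 * p\<^sup>2 + K\<^sup>2 * (N * N') * (3 / 2) * p ^ 4"
    proof -
      have "\<bar>b\<^sub>2\<bar> * p\<^sup>2 * \<bar>R t\<bar> \<le> K * N' * p\<^sup>2 * (K * (M * p + N * p ^ 3))"
        using Rt p b K N w 
        by (intro mult_mono order_trans[OF Rt] mult_left_mono add_mono mult_right_mono mult_nonneg_nonneg add_nonneg_nonneg) auto
      also have "\<dots> = K\<^sup>2 * (N * N') * (q * p ^ 3 + p ^ 5)"
        by (simp add: M q_def[symmetric] algebra_simps eval_nat_numeral)
      also have "\<dots> \<le> K\<^sup>2 * (N * N') * ((d * p\<^sup>2 + p ^ 4) / 2 + p ^ 4)"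
        using p3 p4 N by (intro mult_left_mono add_mono) auto
      also have "\<dots> = K\<^sup>2 * (N * N' * d) / 2 * p\<^sup>2 + K\<^sup>2 * (N * N') * (3 / 2) * p ^ 4"
        by (simp add: field_simps)
      finally show ?thesis unfolding NN .
    qed
    have 5: "\<bar>R t\<bar> * \<bar>S t\<bar> \<le> K\<^sup>2 * (w * w') * p\<^sup>2 + K\<^sup>2 * (N * N') * 3 * p ^ 4"
    proof -
      have "\<bar>R t\<bar> * \<bar>S t\<bar> \<le> K * (w * p + N * p ^ 3) * (K * (w' * p + N' * p ^ 3))"
        using Rt St p K N w by (intro mult_mono) auto
      also have "\<dots> = K\<^sup>2 * (w * w' * p\<^sup>2 + (w * N' + N * w') * p ^ 4 + N * N' * p ^ 6)"
        by (simp add: algebra_simps eval_nat_numeral)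
      also have "\<dots> \<le> K\<^sup>2 * (w * w' * p\<^sup>2 + (N * N' + N * N') * p ^ 4 + N * N' * p ^ 4)"
        using p4 N w w' MN p by (intro mult_left_mono add_mono mult_right_mono) auto
      finally show ?thesis by (simp add: algebra_simps)
    qed
    have "\<alpha> * p\<^sup>2 + \<beta> * p ^ 4
      = (K\<^sup>2 * (\<bar>a\<^sub>1\<bar> * w') * p\<^sup>2 + K\<^sup>2 * (N * N') * p ^ 4) + (K\<^sup>2 * (\<bar>b\<^sub>1\<bar> * w) * p\<^sup>2 + K\<^sup>2 * (N * N') * p ^ 4)
        + (K\<^sup>2 * (M * M') / 2 * p\<^sup>2 + K\<^sup>2 * (N * N') * (3 / 2) * p ^ 4)
        + (K\<^sup>2 * (M * M') / 2 * p\<^sup>2 + K\<^sup>2 * (N * N') * (3 / 2) * p ^ 4)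
        + (K\<^sup>2 * (w * w') * p\<^sup>2 + K\<^sup>2 * (N * N') * 3 * p ^ 4)"
      by (simp add: \<alpha>_def \<beta>_def field_simps)
    with Et[unfolded abs] 1 2 3 4 5 show ?thesis
      unfolding T_def[symmetric] T by linarith
  qed
  have "\<bar>L E\<bar> \<le> L (\<lambda>t. \<alpha> * (t - x)\<^sup>2 + \<beta> * (t - x) ^ 4)"
    using E by (intro abs_le c continuous_intros)
  also have "\<dots> = \<alpha> * (X * d) + \<beta> * L (\<lambda>t. (t - x) ^ 4)"
    by (subst add, intro continuous_intros, intro continuous_intros) (simp only: cmult moment2 X_def)
  also have "\<dots> \<le> \<alpha> * (X * d) + \<beta> * (5 * (X * d\<^sup>2))"
    using moment4 \<alpha> by (intro add_left_mono mult_left_mono) (auto simp: X_def)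
  also have "\<beta> * (5 * (X * d\<^sup>2)) = 40 * (K\<^sup>2 * (X * d) * (N * N' * d))"
    by (simp add: \<beta>_def power2_eq_square)
  finally have LE: "\<bar>L E\<bar> \<le> \<alpha> * (X * d) + 40 * (K\<^sup>2 * (X * d) * (M * M'))"
    unfolding NN .
  \<comment> \<open>A covariance does not change when constants are subtracted, so both functions
    may be centred at their values at \<open>x\<close>.\<close>
  have cov: "L (\<lambda>t. f t * g t) - L f * L g
      = L (\<lambda>t. (f t - f x) * (g t - g x)) - (L f - f x) * (L g - g x)"
  proof -
    have "L (\<lambda>t. (f t - f x) * (g t - g x)) = L (\<lambda>t. ((f t * g t - f x * g t) - g x * f t) + f x * g x)"
      by (rule arg_cong[where f = L]) (auto simp: algebra_simps)
    also have "\<dots> = L (\<lambda>t. f t * g t) - f x * L g - g x * L f + f x * g x"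
    proof -
      have 1: "continuous_on {0..1} (\<lambda>t. f t * g t)" "continuous_on {0..1} (\<lambda>t. f x * g t)"
        "continuous_on {0..1} (\<lambda>t. g x * f t)"
        using f g by (auto intro!: continuous_intros)
      note 2 = continuous_on_diff[OF 1(1,2)]
      show ?thesis
        using add[OF continuous_on_diff[OF 2 1(3)] continuous_on_const] diff[OF 2 1(3)] diff[OF 1(1,2)]
        by (simp only: cmult const)
    qed
    finally show ?thesis by (simp add: algebra_simps)
  qed
  have "L (\<lambda>t. (f t - f x) * (g t - g x)) = L (\<lambda>t. ((E t + a\<^sub>1 * b\<^sub>1 * (t - x)\<^sup>2)
      + (a\<^sub>1 * b\<^sub>2 + a\<^sub>2 * b\<^sub>1) * (t - x) ^ 3) + a\<^sub>2 * b\<^sub>2 * (t - x) ^ 4)"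
    by (rule arg_cong[where f = L]) (auto simp: E_def)
  also have "\<dots> = L E + a\<^sub>1 * b\<^sub>1 * (X * d) + (a\<^sub>1 * b\<^sub>2 + a\<^sub>2 * b\<^sub>1) * L (\<lambda>t. (t - x) ^ 3)
      + a\<^sub>2 * b\<^sub>2 * L (\<lambda>t. (t - x) ^ 4)"
  proof -
    have 1: "continuous_on {0..1} (\<lambda>t. a * (t - x) ^ m)" for a m by (intro continuous_intros)
    note 2 = continuous_on_add[OF c 1]
    note 3 = continuous_on_add[OF 2 1]
    show ?thesis
      unfolding add[OF 3 1] add[OF 2 1] add[OF c 1] by (simp only: cmult moment2 X_def)
  qed
  finally have "\<bar>L (\<lambda>t. f t * g t) - L f * L g - a\<^sub>1 * b\<^sub>1 * (X * d)\<bar>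
    \<le> \<bar>L E\<bar> + \<bar>(a\<^sub>1 * b\<^sub>2 + a\<^sub>2 * b\<^sub>1) * L (\<lambda>t. (t - x) ^ 3)\<bar> + \<bar>a\<^sub>2 * b\<^sub>2 * L (\<lambda>t. (t - x) ^ 4)\<bar>
      + \<bar>(L f - f x) * (L g - g x)\<bar>"
    unfolding cov by linarith
  \<comment> \<open>The signed third moment has order \<open>d^2\<close>. The bound of order
    \<open>d^(3/2)\<close> for the absolute one would not suffice, since \<open>N * N'\<close> needs
    a full factor \<open>d\<close> beyond the variance to become \<open>M * M'\<close>.\<close>
  moreover have "\<bar>(a\<^sub>1 * b\<^sub>2 + a\<^sub>2 * b\<^sub>1) * L (\<lambda>t. (t - x) ^ 3)\<bar> \<le> 4 * (K\<^sup>2 * (X * d) * (M * M'))"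
  proof -
    have "\<bar>a\<^sub>1 * b\<^sub>2\<bar> \<le> K * N * (K * N')" "\<bar>a\<^sub>2 * b\<^sub>1\<bar> \<le> K * N * (K * N')"
      unfolding abs_mult using a b K N by (auto intro!: mult_mono)
    then have "\<bar>a\<^sub>1 * b\<^sub>2 + a\<^sub>2 * b\<^sub>1\<bar> \<le> 2 * (K * N * (K * N'))" by linarith
    then have "\<bar>(a\<^sub>1 * b\<^sub>2 + a\<^sub>2 * b\<^sub>1) * L (\<lambda>t. (t - x) ^ 3)\<bar> \<le> 2 * (K * N * (K * N')) * (2 * (X * d\<^sup>2))"
      unfolding abs_mult[of "_ + _"] using moment3 K N by (intro mult_mono) (auto simp: X_def)
    also have "\<dots> = 4 * (K\<^sup>2 * (X * d) * (N * N' * d))" by (simp add: power2_eq_square)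
    finally show ?thesis unfolding NN .
  qed
  moreover have "\<bar>a\<^sub>2 * b\<^sub>2 * L (\<lambda>t. (t - x) ^ 4)\<bar> \<le> 5 * (K\<^sup>2 * (X * d) * (M * M'))"
  proof -
    have "0 \<le> L (\<lambda>t. (t - x) ^ 4)"
      by (subst const[of 0, symmetric], intro mono continuous_intros) auto
    then have "\<bar>a\<^sub>2 * b\<^sub>2 * L (\<lambda>t. (t - x) ^ 4)\<bar> \<le> K * N * (K * N') * (5 * (X * d\<^sup>2))"
      unfolding abs_mult using a b moment4 K N by (intro mult_mono) (auto simp: X_def)
    also have "\<dots> = 5 * (K\<^sup>2 * (X * d) * (N * N' * d))" by (simp add: power2_eq_square)
    finally show ?thesis unfolding NN .
  qed
  moreover have "\<bar>(L f - f x) * (L g - g x)\<bar> \<le> 25 * (K\<^sup>2 * (X * d) * (M * M'))"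
  proof -
    have "\<bar>L f - f x\<bar> \<le> 5 * K * M * sqrt (X * d)" "\<bar>L g - g x\<bar> \<le> 5 * K * M' * sqrt (X * d)"
      unfolding X_def using K
      by (auto intro!: quadratic_expansion[OF f _ w M a(2) assms(14)] quadratic_expansion[OF g _ w' M' b(2) assms(15)])
    then have "\<bar>(L f - f x) * (L g - g x)\<bar> \<le> (5 * K * M * sqrt (X * d)) * (5 * K * M' * sqrt (X * d))"
      unfolding abs_mult using K w X d by (intro mult_mono) auto
    also have "\<dots> = 25 * (K\<^sup>2 * (sqrt (X * d) * sqrt (X * d)) * (M * M'))"
      by (simp only: power2_eq_square) (simp add: mult_ac)
    also have "sqrt (X * d) * sqrt (X * d) = X * d" using X d by simp
    finally show ?thesis .
  qed
  \<comment> \<open>Here \<open>74 = 40 + 4 + 5 + 25\<close>. It is then enlarged to 79, and the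
    single copy in \<open>\<alpha>\<close> makes 80.\<close>
  ultimately have "\<bar>L (\<lambda>t. f t * g t) - L f * L g - a\<^sub>1 * b\<^sub>1 * (X * d)\<bar>
      \<le> \<alpha> * (X * d) + 74 * (K\<^sup>2 * (X * d) * (M * M'))"
    using LE by linarith
  also have "74 * (K\<^sup>2 * (X * d) * (M * M'))
      \<le> 79 * (K\<^sup>2 * (X * d) * (w * w' + \<bar>a\<^sub>1\<bar> * w' + \<bar>b\<^sub>1\<bar> * w + M * M'))"
    using X d w w' MM by (intro mult_mono) auto
  finally show ?thesis by (simp add: \<alpha>_def X_def algebra_simps)
qed

end

section \<open>Local quadratic approximation\<close>

definition diff3 :: "(real \<Rightarrow> real) \<Rightarrow> real \<Rightarrow> real \<Rightarrow> real" where
  "diff3 u r y = u (y + 3 * r) - 3 * u (y + 2 * r) + 3 * u (y + r) - u y"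

text \<open>Applied to a third antiderivative of \<open>h\<close>, this is the third order Steklov mean of \<open>h\<close>, that is
  the average of \<open>3 h(y + \<sigma>) - 3 h(y + 2\<sigma>) + h(y + 3\<sigma>)\<close> over
  \<open>\<sigma> = T(u\<^sub>1 + u\<^sub>2 + u\<^sub>3)\<close> with \<open>u\<^sub>i\<close> in \<open>[0, 1]\<close>.\<close>

definition steklov :: "real \<Rightarrow> (real \<Rightarrow> real) \<Rightarrow> real \<Rightarrow> real" where
  "steklov T u y = (3 * diff3 u T y - 3 / 8 * diff3 u (2 * T) y + 1 / 27 * diff3 u (3 * T) y) / T ^ 3"

lemma DERIV_steklov:
  assumes "\<And>y. DERIV u y :> u' y"
  shows "DERIV (steklov T u) y :> steklov T u' y"
proof -
  note [derivative_intros] = DERIV_chain2[where f = u and Db = 1, OF assms, simplified]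
  show ?thesis
    unfolding steklov_def[abs_def] diff3_def
    by (intro DERIV_cdivide) (auto intro!: derivative_eq_intros simp: field_simps)
qed

lemma abs_le_of_deriv_bounded:
  fixes V :: "real \<Rightarrow> real"
  assumes "V 0 = 0" "0 \<le> B" and "\<And>r. 0 \<le> r \<Longrightarrow> r \<le> T \<Longrightarrow> DERIV V r :> V' r"
    and "\<And>r. 0 \<le> r \<Longrightarrow> r \<le> T \<Longrightarrow> \<bar>V' r\<bar> \<le> B" and "0 \<le> r" "r \<le> T"
  shows "\<bar>V r\<bar> \<le> B * T"
proof -
  have "norm (V r - V 0) \<le> B * norm (r - 0)"
    by (rule field_differentiable_bound[where S = "{0..T}" and f' = V'])
      (use assms in \<open>auto intro: has_field_derivative_at_within\<close>)
  also have "\<dots> \<le> B * T" using assms by (intro mult_left_mono) auto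
  finally show ?thesis using assms(1) by simp
qed

text \<open>The differentiation is in the step \<open>r\<close>, not in \<open>y\<close>. The
  function \<open>W\<^sub>0\<close>, which is \<open>r ^ 3\<close> times the error, vanishes at 0
  together with \<open>W\<^sub>1\<close> and \<open>W\<^sub>2\<close>, while the weights 3, -3/8,
  1/27 make its third derivative a combination of third differences of \<open>h\<close> with steps
  \<open>r\<close>, \<open>2 r\<close>, \<open>3 r\<close>. Their coefficients 3, 24, 27 sum to 54,
  and three integrations return the factor \<open>T ^ 3\<close>.\<close>

lemma steklov_error:
  assumes F: "\<And>y. DERIV F\<^sub>3 y :> F\<^sub>2 y" "\<And>y. DERIV F\<^sub>2 y :> F\<^sub>1 y" "\<And>y. DERIV F\<^sub>1 y :> h y"
    and T: "T > 0" and w: "\<And>r. 0 \<le> r \<Longrightarrow> r \<le> 3 * T \<Longrightarrow> \<bar>diff3 h r y\<bar> \<le> w"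
  shows "\<bar>h y - steklov T F\<^sub>3 y\<bar> \<le> 54 * w"
proof -
  define W\<^sub>0 where "W\<^sub>0 r = 3 * diff3 F\<^sub>3 r y - 3 / 8 * diff3 F\<^sub>3 (2 * r) y + 1 / 27 * diff3 F\<^sub>3 (3 * r) y
    - r ^ 3 * h y" for r
  define W\<^sub>1 where "W\<^sub>1 r = 9 * F\<^sub>2 (y + 3 * r) - 18 * F\<^sub>2 (y + 2 * r) + 9 * F\<^sub>2 (y + r)
    - 3 / 8 * (6 * F\<^sub>2 (y + 6 * r) - 12 * F\<^sub>2 (y + 4 * r) + 6 * F\<^sub>2 (y + 2 * r))
    + 1 / 27 * (9 * F\<^sub>2 (y + 9 * r) - 18 * F\<^sub>2 (y + 6 * r) + 9 * F\<^sub>2 (y + 3 * r)) - 3 * r\<^sup>2 * h y" for r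
  define W\<^sub>2 where "W\<^sub>2 r = 27 * F\<^sub>1 (y + 3 * r) - 36 * F\<^sub>1 (y + 2 * r) + 9 * F\<^sub>1 (y + r)
    - 3 / 8 * (36 * F\<^sub>1 (y + 6 * r) - 48 * F\<^sub>1 (y + 4 * r) + 12 * F\<^sub>1 (y + 2 * r))
    + 1 / 27 * (81 * F\<^sub>1 (y + 9 * r) - 108 * F\<^sub>1 (y + 6 * r) + 27 * F\<^sub>1 (y + 3 * r)) - 6 * r * h y" for r
  define W\<^sub>3 where "W\<^sub>3 r = 27 * diff3 h (3 * r) y - 24 * diff3 h (2 * r) y + 3 * diff3 h r y" for r
  note [derivative_intros] = DERIV_chain2[where f = F\<^sub>3 and Db = c for c, OF F(1)]
    DERIV_chain2[where f = F\<^sub>2 and Db = c for c, OF F(2)] DERIV_chain2[where f = F\<^sub>1 and Db = c for c, OF F(3)]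
  have D: "DERIV W\<^sub>0 r :> W\<^sub>1 r" "DERIV W\<^sub>1 r :> W\<^sub>2 r" "DERIV W\<^sub>2 r :> W\<^sub>3 r" for r
    unfolding W\<^sub>0_def[abs_def] W\<^sub>1_def[abs_def] W\<^sub>2_def[abs_def] W\<^sub>3_def diff3_def
    by (auto intro!: derivative_eq_intros simp: algebra_simps)
  have "0 \<le> w" using w[of 0] T by (simp add: diff3_def)
  have b3: "\<bar>W\<^sub>3 r\<bar> \<le> 54 * w" if "0 \<le> r" "r \<le> T" for r
    using w[of r] w[of "2 * r"] w[of "3 * r"] that unfolding W\<^sub>3_def by linarith
  have b2: "\<bar>W\<^sub>2 r\<bar> \<le> 54 * w * T" if "0 \<le> r" "r \<le> T" for r
    by (rule abs_le_of_deriv_bounded[OF _ _ D(3) b3]) (use that \<open>0 \<le> w\<close> in \<open>auto simp: W\<^sub>2_def\<close>)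
  have b1: "\<bar>W\<^sub>1 r\<bar> \<le> 54 * w * T * T" if "0 \<le> r" "r \<le> T" for r
    by (rule abs_le_of_deriv_bounded[OF _ _ D(2) b2]) (use that \<open>0 \<le> w\<close> in \<open>auto simp: W\<^sub>1_def\<close>)
  have "\<bar>W\<^sub>0 T\<bar> \<le> 54 * w * T * T * T"
    by (rule abs_le_of_deriv_bounded[OF _ _ D(1) b1]) (use T \<open>0 \<le> w\<close> in \<open>auto simp: W\<^sub>0_def diff3_def\<close>)
  also have "W\<^sub>0 T = T ^ 3 * (steklov T F\<^sub>3 y - h y)"
    using T by (simp add: W\<^sub>0_def steklov_def field_simps)
  finally have "T ^ 3 * \<bar>steklov T F\<^sub>3 y - h y\<bar> \<le> T ^ 3 * (54 * w)"
    using T by (simp add: abs_mult power3_eq_cube mult_ac)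
  then show ?thesis using T by (simp add: abs_minus_commute)
qed

text \<open>The Steklov mean of \<open>f\<close> is expanded by Taylor's formula, its fourth
  derivative being a third difference of \<open>h\<close> divided by \<open>T ^ 3\<close>. The
  difference between \<open>f\<close> and its mean has a derivative of size \<open>54 w\<close>,
  which accounts for the term linear in \<open>\<bar>t - x\<bar>\<close>.\<close>

lemma local_cubic_approximation:
  fixes f h :: "real \<Rightarrow> real"
  assumes f: "\<And>y. DERIV f y :> h y" and h: "continuous_on UNIV h" and s: "0 < s" "s \<le> 1"
    and w: "\<And>y r. 0 \<le> r \<Longrightarrow> r \<le> s \<Longrightarrow> 0 \<le> y \<Longrightarrow> y + 3 * r \<le> 1 \<Longrightarrow> \<bar>diff3 h r y\<bar> \<le> w"
    and x: "0 \<le> x" "x \<le> 1 / 2"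
  obtains a\<^sub>1 a\<^sub>2 a\<^sub>3 where "\<bar>h x - a\<^sub>1\<bar> \<le> 54 * w"
    "\<And>t. 0 \<le> t \<Longrightarrow> t \<le> 2 / 3 \<Longrightarrow> \<bar>f t - f x - a\<^sub>1 * (t - x) - a\<^sub>2 * (t - x)\<^sup>2 - a\<^sub>3 * (t - x) ^ 3\<bar>
      \<le> 54 * w * \<bar>t - x\<bar> + 3281 * (w / s ^ 3) * (t - x) ^ 4"
proof -
  have ex: "\<exists>F. \<forall>y. DERIV F y :> g y" if "continuous_on UNIV g" for g :: "real \<Rightarrow> real"
    using einterval_antiderivative[of "-\<infinity>" "\<infinity>" g] that
    by (auto simp: has_real_derivative_iff_has_vector_derivative continuous_on_eq_continuous_at)
  have cont: "continuous_on UNIV F" if "\<And>y. DERIV F y :> g y" for F g :: "real \<Rightarrow> real"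
    using that by (meson DERIV_continuous_on DERIV_subset subset_UNIV)
  obtain F\<^sub>2 where F2: "\<And>y. DERIV F\<^sub>2 y :> f y" using ex[OF cont[OF f]] by blast
  obtain F\<^sub>3 where F3: "\<And>y. DERIV F\<^sub>3 y :> F\<^sub>2 y" using ex[OF cont[OF F2]] by blast
  obtain F\<^sub>4 where F4: "\<And>y. DERIV F\<^sub>4 y :> F\<^sub>3 y" using ex[OF cont[OF F3]] by blast
  \<comment> \<open>The differences have steps up to \<open>3 T\<close> and reach
    \<open>9 T = s / 3\<close> to the right, so they stay in the unit interval for base points up to
    2/3.\<close>
  define T where "T = s / 27"
  have T: "T > 0" using s by (simp add: T_def)
  have w0: "0 \<le> w" using w[of 0 0] s by (simp add: diff3_def)
  \<comment> \<open>\<open>F\<^sub>4\<close> is a third antiderivative of \<open>f\<close>, so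
    \<open>G 0\<close> is the smoothed \<open>f\<close>, \<open>G 1\<close> the smoothed
    \<open>h\<close>, and each index counts one more derivative.\<close>
  define G where "G = (\<lambda>m::nat. steklov T ([F\<^sub>4, F\<^sub>3, F\<^sub>2, f, h] ! m))"
  have G: "DERIV (G m) y :> G (Suc m) y" if "m < 4" for m y
  proof -
    from that have "m = 0 \<or> m = 1 \<or> m = 2 \<or> m = 3" by auto
    then show ?thesis
      using DERIV_steklov[OF F4] DERIV_steklov[OF F3] DERIV_steklov[OF F2] DERIV_steklov[OF f]
      by (auto simp: G_def)
  qed
  have wT: "\<bar>diff3 h r y\<bar> \<le> w" if "0 \<le> r" "r \<le> 3 * T" "0 \<le> y" "y \<le> 2 / 3" for r y
    using that s by (intro w) (auto simp: T_def)
  have err: "\<bar>h y - G 1 y\<bar> \<le> 54 * w" if "0 \<le> y" "y \<le> 2 / 3" for y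
    unfolding G_def using steklov_error[OF F3 F2 f T wT] that by simp
  \<comment> \<open>The weights \<open>3 + 3/8 + 1/27\<close> are below 4, and
    \<open>4 * 27^3 = 78732\<close> is at most \<open>24 * 3281\<close>; the 24 cancels against
    \<open>fact 4\<close>.\<close>
  have G4: "\<bar>G 4 y\<bar> \<le> 24 * (3281 * (w / s ^ 3))" if "0 \<le> y" "y \<le> 2 / 3" for y
  proof -
    have "\<bar>3 * diff3 h T y - 3 / 8 * diff3 h (2 * T) y + 1 / 27 * diff3 h (3 * T) y\<bar> \<le> 4 * w"
      using wT[of T y] wT[of "2 * T" y] wT[of "3 * T" y] that T by linarith
    then have "\<bar>steklov T h y\<bar> \<le> 4 * w / T ^ 3"
      using T by (simp add: steklov_def divide_right_mono abs_divide)
    also have "\<dots> = 78732 * (w / s ^ 3)" by (simp add: T_def power3_eq_cube)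
    also have "\<dots> \<le> 24 * (3281 * (w / s ^ 3))" using w0 s by (simp add: divide_right_mono)
    finally show ?thesis by (simp add: G_def)
  qed
  have "\<bar>f t - f x - G 1 x * (t - x) - (G 2 x / 2) * (t - x)\<^sup>2 - (G 3 x / 6) * (t - x) ^ 3\<bar>
      \<le> 54 * w * \<bar>t - x\<bar> + 3281 * (w / s ^ 3) * (t - x) ^ 4" if t: "0 \<le> t" "t \<le> 2 / 3" for t
  proof (cases "t = x")
    case False
    have "\<exists>\<xi>. (if t < x then t < \<xi> \<and> \<xi> < x else x < \<xi> \<and> \<xi> < t) \<and>
        G 0 t = (\<Sum>m<4. G m x / fact m * (t - x) ^ m) + G 4 \<xi> / fact 4 * (t - x) ^ 4"
      by (rule Taylor[where a = 0 and b = "2 / 3"]) (use t x G False in auto)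
    then obtain \<xi> where between: "if t < x then t < \<xi> \<and> \<xi> < x else x < \<xi> \<and> \<xi> < t"
      and "G 0 t = (\<Sum>m<4. G m x / fact m * (t - x) ^ m) + G 4 \<xi> / fact 4 * (t - x) ^ 4"
      by blast
    moreover from between have \<xi>: "0 \<le> \<xi>" "\<xi> \<le> 2 / 3" using t x by (auto split: if_splits)
    ultimately have "G 0 t - G 0 x - G 1 x * (t - x) - (G 2 x / 2) * (t - x)\<^sup>2 - (G 3 x / 6) * (t - x) ^ 3
        = G 4 \<xi> / 24 * (t - x) ^ 4"
      by (simp add: eval_nat_numeral)
    moreover have "\<bar>G 4 \<xi> / 24 * (t - x) ^ 4\<bar> \<le> 3281 * (w / s ^ 3) * (t - x) ^ 4"
      using G4[OF \<xi>] unfolding abs_mult by (intro mult_mono) auto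
    moreover have "norm ((f t - G 0 t) - (f x - G 0 x)) \<le> 54 * w * norm (t - x)"
      by (rule field_differentiable_bound[where S = "{0..2 / 3}" and f' = "\<lambda>y. h y - G 1 y"])
        (use t x err in \<open>auto intro!: derivative_intros has_field_derivative_at_within[OF f]
           has_field_derivative_at_within[OF G[of 0, simplified]]\<close>)
    ultimately have "\<bar>((f t - G 0 t) - (f x - G 0 x)) + (G 0 t - G 0 x - G 1 x * (t - x) - (G 2 x / 2) * (t - x)\<^sup>2
        - (G 3 x / 6) * (t - x) ^ 3)\<bar> \<le> 54 * w * \<bar>t - x\<bar> + 3281 * (w / s ^ 3) * (t - x) ^ 4"
      unfolding real_norm_def by (intro order_trans[OF abs_triangle_ineq add_mono]) simp_all
    then show ?thesis by simp
  qed simp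
  then show ?thesis using that[of "G 1 x" "G 2 x / 2" "G 3 x / 6"] err[of x] x by auto
qed


text \<open>The bound \<open>w \<le> s ^ 3 * N\<close> turns \<open>w / s ^ 3\<close> into
  \<open>N\<close>. Once the coefficients of the local cubic are \<open>O(N)\<close>, its cubic term
  joins the remainder, and replacing \<open>a\<^sub>1\<close> by \<open>h x\<close> costs only
  another multiple of \<open>w * \<bar>t - x\<bar>\<close>. For \<open>x \<le> 1/2\<close> there is
  room of length 1/6 to the right of \<open>x\<close> inside the range of the local
  expansion.\<close>

lemma quadratic_approximation_left:
  fixes f h :: "real \<Rightarrow> real"
  assumes f: "\<And>y. DERIV f y :> h y" and h: "continuous_on UNIV h" and s: "0 < s" "s \<le> 1"
    and w: "\<And>y r. 0 \<le> r \<Longrightarrow> r \<le> s \<Longrightarrow> 0 \<le> y \<Longrightarrow> y + 3 * r \<le> 1 \<Longrightarrow> \<bar>diff3 h r y\<bar> \<le> w"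
    and x: "0 \<le> x" "x \<le> 1 / 2"
    and N: "\<And>t. 0 \<le> t \<Longrightarrow> t \<le> 1 \<Longrightarrow> \<bar>f t\<bar> \<le> N" "w \<le> s ^ 3 * N"
  shows "\<bar>h x\<bar> \<le> 6000000 * N"
    and "\<exists>a. \<bar>a\<bar> \<le> 6000000 * N \<and> (\<forall>t\<in>{0..1}.
      \<bar>f t - f x - h x * (t - x) - a * (t - x)\<^sup>2\<bar> \<le> 6000000 * (w * \<bar>t - x\<bar> + N * \<bar>t - x\<bar> ^ 3))"
proof -
  obtain a\<^sub>1 a\<^sub>2 a\<^sub>3 where a1: "\<bar>h x - a\<^sub>1\<bar> \<le> 54 * w"
    and a: "\<And>t. 0 \<le> t \<Longrightarrow> t \<le> 2 / 3 \<Longrightarrow> \<bar>f t - f x - a\<^sub>1 * (t - x) - a\<^sub>2 * (t - x)\<^sup>2 - a\<^sub>3 * (t - x) ^ 3\<bar>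
      \<le> 54 * w * \<bar>t - x\<bar> + 3281 * (w / s ^ 3) * (t - x) ^ 4"
    using local_cubic_approximation[OF f h s w x] by blast
  have w0: "0 \<le> w" using w[of 0 0] s by (simp add: diff3_def)
  have N0: "0 \<le> N" using N(1)[of 0] by simp
  have "s ^ 3 * N \<le> 1 * N" using s N0 by (intro mult_right_mono power_le_one) auto
  then have wN: "w \<le> N" using N(2) by simp
  have wsN: "w / s ^ 3 \<le> N" using N(2) s by (simp add: field_simps)
  \<comment> \<open>The cubic is \<open>O(N)\<close> at \<open>x + 1/18\<close>, \<open>x + 1/9\<close>, \<open>x + 1/6\<close>, which determines its coefficients.\<close>
  have pt: "\<bar>a\<^sub>1 * e + a\<^sub>2 * e\<^sup>2 + a\<^sub>3 * e ^ 3\<bar> \<le> 14 * N" if "0 < e" "e \<le> 1 / 6" for e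
  proof -
    have "54 * w * \<bar>e\<bar> + 3281 * (w / s ^ 3) * e ^ 4 \<le> 54 * N * (1 / 6) + 3281 * N * (1 / 6) ^ 4"
      using that wN wsN N0 w0 s by (intro add_mono mult_mono power_mono) auto
    also have "\<dots> \<le> 12 * N" using N0 by (simp add: eval_nat_numeral)
    finally have "\<bar>f (x + e) - f x - a\<^sub>1 * e - a\<^sub>2 * e\<^sup>2 - a\<^sub>3 * e ^ 3\<bar> \<le> 12 * N"
      using a[of "x + e"] that x by simp
    moreover have "\<bar>f (x + e) - f x\<bar> \<le> 2 * N"
      using N(1)[of x] N(1)[of "x + e"] that x by (simp add: abs_le_iff)
    ultimately have "\<bar>(f (x + e) - f x) - (f (x + e) - f x - a\<^sub>1 * e - a\<^sub>2 * e\<^sup>2 - a\<^sub>3 * e ^ 3)\<bar> \<le> 2 * N + 12 * N"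
      by (intro order_trans[OF abs_triangle_ineq4 add_mono])
    then show ?thesis by simp
  qed
  have V: "\<bar>a\<^sub>1 / 18 + a\<^sub>2 / 324 + a\<^sub>3 / 5832\<bar> \<le> 14 * N"
    "\<bar>a\<^sub>1 / 9 + a\<^sub>2 / 81 + a\<^sub>3 / 729\<bar> \<le> 14 * N"
    "\<bar>a\<^sub>1 / 6 + a\<^sub>2 / 36 + a\<^sub>3 / 216\<bar> \<le> 14 * N"
    using pt[of "1 / 18"] pt[of "1 / 9"] pt[of "1 / 6"] by (simp_all add: power_divide)
  \<comment> \<open>Inverting the system for the nodes \<open>e\<close>, \<open>2 e\<close>,
    \<open>3 e\<close> with \<open>e = 1/18\<close> gives absolute row sums 29/6, 5, 7/6. They are
    multiplied by 14 and by 18, \<open>18^2\<close>, \<open>18^3\<close> respectively, with the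
    first and third rounded up.\<close>
  have A: "\<bar>a\<^sub>1\<bar> \<le> 1219 * N" "\<bar>a\<^sub>2\<bar> \<le> 22680 * N" "\<bar>a\<^sub>3\<bar> \<le> 95257 * N"
    using V by linarith+
  have hx: "\<bar>h x\<bar> \<le> 1273 * N" using a1 A wN by linarith
  then show "\<bar>h x\<bar> \<le> 6000000 * N" using N0 by linarith
  have "\<bar>f t - f x - h x * (t - x) - a\<^sub>2 * (t - x)\<^sup>2\<bar> \<le> 6000000 * (w * \<bar>t - x\<bar> + N * \<bar>t - x\<bar> ^ 3)"
    if t: "t \<in> {0..1}" for t
  proof (cases "t \<le> 2 / 3")
    case True
    define p where "p = \<bar>t - x\<bar>"
    have p: "0 \<le> p" "p \<le> 1" using t x by (auto simp: p_def)
    have p4: "(t - x) ^ 4 \<le> p ^ 3"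
      using power_decreasing[of 3 4 p] p by (simp add: p_def power_even_abs)
    have "\<bar>f t - f x - h x * (t - x) - a\<^sub>2 * (t - x)\<^sup>2\<bar>
      \<le> \<bar>f t - f x - a\<^sub>1 * (t - x) - a\<^sub>2 * (t - x)\<^sup>2 - a\<^sub>3 * (t - x) ^ 3\<bar>
        + \<bar>(h x - a\<^sub>1) * (t - x)\<bar> + \<bar>a\<^sub>3 * (t - x) ^ 3\<bar>"
      unfolding left_diff_distrib by linarith
    also have "\<dots> \<le> (54 * w * p + 3281 * N * p ^ 3) + 54 * w * p + 95257 * N * p ^ 3"
    proof (intro add_mono)
      have "3281 * (w / s ^ 3) * (t - x) ^ 4 \<le> 3281 * N * p ^ 3"
        using wsN N0 p4 w0 s by (intro mult_mono) auto
      then show "\<bar>f t - f x - a\<^sub>1 * (t - x) - a\<^sub>2 * (t - x)\<^sup>2 - a\<^sub>3 * (t - x) ^ 3\<bar>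
          \<le> 54 * w * p + 3281 * N * p ^ 3"
        using a[of t] t True by (simp add: p_def)
      show "\<bar>(h x - a\<^sub>1) * (t - x)\<bar> \<le> 54 * w * p"
        unfolding abs_mult p_def using a1 by (intro mult_right_mono) auto
      show "\<bar>a\<^sub>3 * (t - x) ^ 3\<bar> \<le> 95257 * N * p ^ 3"
        unfolding abs_mult p_def power_abs using A by (intro mult_right_mono) auto
    qed
    also have "\<dots> = 108 * (w * p) + 98538 * (N * p ^ 3)" by simp
    also have "\<dots> \<le> 6000000 * (w * p) + 6000000 * (N * p ^ 3)"
      using w0 N0 p by (intro add_mono mult_right_mono) auto
    finally show ?thesis by (simp add: p_def)
  next
    case False \<comment> \<open>No smoothness is needed here, as \<open>N\<bar>t - x\<bar>\<^sup>3\<close> is comparable to \<open>N\<close>.\<close>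
    have d: "1 / 6 \<le> \<bar>t - x\<bar>" "\<bar>t - x\<bar> \<le> 1" using False x t by auto
    have "\<bar>h x * (t - x)\<bar> \<le> 1273 * N * 1"
      unfolding abs_mult using hx d N0 by (intro mult_mono) auto
    moreover have "\<bar>a\<^sub>2 * (t - x)\<^sup>2\<bar> \<le> 22680 * N * 1"
      unfolding abs_mult using A d N0 by (intro mult_mono) (auto simp: abs_square_le_1)
    moreover have "\<bar>f t\<bar> \<le> N" "\<bar>f x\<bar> \<le> N" using N(1) t x by auto
    ultimately have "\<bar>f t - f x - h x * (t - x) - a\<^sub>2 * (t - x)\<^sup>2\<bar> \<le> 25955 * N"
      by linarith
    \<comment> \<open>This is the source of the constant 6000000, which exceeds
      \<open>25955 * 6^3\<close>; all other constants are much smaller.\<close>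
    also have "25955 * N \<le> 6000000 * (N * (1 / 6) ^ 3)" using N0 by (simp add: power_divide)
    also have "\<dots> \<le> 6000000 * (w * \<bar>t - x\<bar> + N * \<bar>t - x\<bar> ^ 3)"
      using d N0 w0 by (intro mult_left_mono add_increasing mult_nonneg_nonneg power_mono) auto
    finally show ?thesis .
  qed
  then show "\<exists>a. \<bar>a\<bar> \<le> 6000000 * N \<and> (\<forall>t\<in>{0..1}.
      \<bar>f t - f x - h x * (t - x) - a * (t - x)\<^sup>2\<bar> \<le> 6000000 * (w * \<bar>t - x\<bar> + N * \<bar>t - x\<bar> ^ 3))"
    using A N0 by (intro exI[of _ a\<^sub>2]) auto
qed

section \<open>Extension to the real line, moduli and norms on the unit interval\<close>

lemma C1_01_extend:
  assumes "C1_01 f f'"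
  obtains F F' where "\<And>y. DERIV F y :> F' y" "continuous_on UNIV F'"
    "\<And>t. t \<in> {0..1} \<Longrightarrow> F t = f t" "\<And>t. t \<in> {0..1} \<Longrightarrow> F' t = f' t"
proof -
  \<comment> \<open>Clamping the argument continues the derivative by constants. An antiderivative
    of it, normalised at 0, extends \<open>f\<close> and has two-sided derivatives everywhere, as
    repeated antidifferentiation on the line requires.\<close>
  define F' where "F' t = f' (max 0 (min 1 t))" for t
  have c: "continuous_on UNIV F'"
  proof -
    have "continuous_on {0..1} f'" using assms by (simp add: C1_01_def)
    moreover have "continuous_on UNIV (\<lambda>t::real. max 0 (min 1 t))" by (intro continuous_intros)
    ultimately show ?thesis
      unfolding F'_def[abs_def] by (rule continuous_on_compose2) auto
  qed
  then have "\<exists>F. \<forall>y. DERIV F y :> F' y"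
    using einterval_antiderivative[of "-\<infinity>" "\<infinity>" F']
    by (auto simp: has_real_derivative_iff_has_vector_derivative continuous_on_eq_continuous_at)
  then obtain F where F: "\<And>y. DERIV F y :> F' y" by blast
  have eq: "F' t = f' t" if "t \<in> {0..1}" for t using that by (auto simp: F'_def)
  define G where "G y = F y - F 0 + f 0" for y
  have G: "DERIV G y :> F' y" for y
    unfolding G_def[abs_def]
    by (rule DERIV_cong[OF DERIV_add[OF DERIV_diff[OF F DERIV_const] DERIV_const]]) simp
  have Gf: "G t = f t" if t: "t \<in> {0..1}" for t
  proof -
    have "((\<lambda>y. G y - f y) has_real_derivative 0) (at y within {0..1})" if "y \<in> {0..1}" for y
    proof -
      have "(f has_real_derivative F' y) (at y within {0..1})"
        using assms that by (simp add: C1_01_def eq)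
      from DERIV_diff[OF has_field_derivative_at_within[OF G] this] show ?thesis by simp
    qed
    then have "\<exists>c. \<forall>y\<in>{0..1}. G y - f y = c"
      by (intro has_field_derivative_zero_constant) auto
    then obtain c where c: "\<And>y. y \<in> {0..1} \<Longrightarrow> G y - f y = c" by blast
    show ?thesis using c[of 0] c[OF t] by (simp add: G_def)
  qed
  show ?thesis using G c Gf eq by (rule that)
qed

text \<open>A real supremum dominates the members of its set only once the set is bounded above;
  here compactness gives the bound \<open>8 B\<close>, from \<open>1 + 3 + 3 + 1\<close>.\<close>

lemma omega3_bound:
  assumes h: "continuous_on {0..1} h" and r: "0 < r" "r \<le> s" "0 \<le> y" "y + 3 * r \<le> 1"
  shows "\<bar>diff3 h r y\<bar> \<le> omega3 h s"
proof -
  have "bounded (h ` {0..1})" using h by (intro compact_imp_bounded compact_continuous_image) auto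
  then obtain B where B: "\<forall>z\<in>{0..1}. \<bar>h z\<bar> \<le> B" by (auto simp: bounded_iff)
  have "\<bar>h (z + 3 * u) - 3 * h (z + 2 * u) + 3 * h (z + u) - h z\<bar> \<le> 8 * B"
    if "0 < u" "0 \<le> z" "z + 3 * u \<le> 1" for z u
  proof -
    have "\<bar>h (z + 3 * u)\<bar> \<le> B" "\<bar>h (z + 2 * u)\<bar> \<le> B" "\<bar>h (z + u)\<bar> \<le> B" "\<bar>h z\<bar> \<le> B"
      using that by (auto intro!: B[rule_format])
    then show ?thesis by linarith
  qed
  then have "bdd_above {\<bar>h (x + 3*t) - 3 * h (x + 2*t) + 3 * h (x + t) - h x\<bar> | x t.
      0 < t \<and> t \<le> s \<and> 0 \<le> x \<and> x + 3*t \<le> 1}"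
    by (intro bdd_aboveI[of _ "8 * B"]) auto
  then show ?thesis unfolding omega3_def diff3_def using r by (intro cSup_upper) auto
qed

lemma omega3_nonneg:
  assumes "continuous_on {0..1} h" "s > 0"
  shows "omega3 h s \<ge> 0"
proof -
  \<comment> \<open>The step is cut at 1/3 so that the three increments from 0 stay in the interval,
    which exhibits a member of the set.\<close>
  have "0 \<le> \<bar>diff3 h (min s (1 / 3)) 0\<bar>" by simp
  also have "\<dots> \<le> omega3 h s" using assms by (intro omega3_bound) auto
  finally show ?thesis .
qed

lemma supnorm_bound:
  assumes "continuous_on {0..1} h" "t \<in> {0..1}"
  shows "\<bar>h t\<bar> \<le> supnorm h"
proof -
  have "bounded (h ` {0..1})" using assms(1) by (intro compact_imp_bounded compact_continuous_image) auto
  then obtain B where "\<forall>z\<in>{0..1}. \<bar>h z\<bar> \<le> B" by (auto simp: bounded_iff)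
  then have "bdd_above ((\<lambda>x. \<bar>h x\<bar>) ` {0..1})" by (intro bdd_aboveI2[of _ _ B]) auto
  then show ?thesis unfolding supnorm_def using assms(2) by (intro cSUP_upper)
qed

lemma C1_01_continuous: "C1_01 f f' \<Longrightarrow> continuous_on {0..1} f \<and> continuous_on {0..1} f'"
  unfolding C1_01_def using DERIV_continuous_on[of "{0..1}" f f'] by blast

text \<open>Points in the right half are reduced to the left half by the reflection
  \<open>1 - t\<close>. Both the derivative and the third difference change sign under it, so the
  bound by the modulus is preserved.\<close>

lemma quadratic_approximation:
  assumes f: "C1_01 f f'" and s: "0 < s" "s \<le> 1" and x: "x \<in> {0..1}"
    and N: "\<And>t. t \<in> {0..1} \<Longrightarrow> \<bar>f t\<bar> \<le> N" "omega3 f' s \<le> s ^ 3 * N"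
  shows "\<bar>f' x\<bar> \<le> 6000000 * N"
    and "\<exists>a. \<bar>a\<bar> \<le> 6000000 * N \<and> (\<forall>t\<in>{0..1}. \<bar>f t - f x - f' x * (t - x) - a * (t - x)\<^sup>2\<bar>
      \<le> 6000000 * (omega3 f' s * \<bar>t - x\<bar> + N * \<bar>t - x\<bar> ^ 3))"
proof -
  obtain F F' where F: "\<And>y. DERIV F y :> F' y" "continuous_on UNIV F'"
    and eq: "\<And>t. t \<in> {0..1} \<Longrightarrow> F t = f t" "\<And>t. t \<in> {0..1} \<Longrightarrow> F' t = f' t"
    using C1_01_extend[OF f] by blast
  have c: "continuous_on {0..1} f'" using C1_01_continuous[OF f] by blast
  have w: "\<bar>diff3 F' r y\<bar> \<le> omega3 f' s" if "0 \<le> r" "r \<le> s" "0 \<le> y" "y + 3 * r \<le> 1" for y r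
  \<comment> \<open>The modulus ranges over positive steps only, whereas the local estimates also
    admit step 0.\<close>
  proof (cases "r = 0")
    case True
    then show ?thesis using omega3_nonneg[OF c s(1)] by (simp add: diff3_def)
  next
    case False
    then have "diff3 F' r y = diff3 f' r y" using that eq(2) by (simp add: diff3_def)
    then show ?thesis using omega3_bound[OF c, of r s y] that False by simp
  qed
  have "\<bar>f' x\<bar> \<le> 6000000 * N \<and> (\<exists>a. \<bar>a\<bar> \<le> 6000000 * N \<and>
    (\<forall>t\<in>{0..1}. \<bar>f t - f x - f' x * (t - x) - a * (t - x)\<^sup>2\<bar>
      \<le> 6000000 * (omega3 f' s * \<bar>t - x\<bar> + N * \<bar>t - x\<bar> ^ 3)))"
  proof (cases "x \<le> 1 / 2")
    case True
    show ?thesis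
    proof -
      have N': "\<bar>F t\<bar> \<le> N" if "0 \<le> t" "t \<le> 1" for t using that N(1)[of t] eq(1)[of t] by simp
      have x0: "0 \<le> x" using x by simp
      show ?thesis
        using quadratic_approximation_left[OF F s w x0 True N' N(2)] eq[OF x] eq(1) by simp
    qed
  next
    case False
    define G G' where "G t = F (1 - t)" and "G' t = - F' (1 - t)" for t
    have G: "DERIV G y :> G' y" for y
      unfolding G_def[abs_def] G'_def
    proof -
      have "((\<lambda>t. 1 - t) has_real_derivative -1) (at y)"
        by (auto intro!: derivative_eq_intros)
      from DERIV_chain2[OF F(1) this] show "((\<lambda>t. F (1 - t)) has_real_derivative - F' (1 - y)) (at y)"
        by simp
    qed
    have c': "continuous_on UNIV G'"
      unfolding G'_def[abs_def]
      by (intro continuous_on_minus continuous_on_compose2[OF F(2)]) (auto intro!: continuous_intros)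
    have w': "\<bar>diff3 G' r y\<bar> \<le> omega3 f' s" if "0 \<le> r" "r \<le> s" "0 \<le> y" "y + 3 * r \<le> 1" for y r
    proof -
      have "diff3 G' r y = diff3 F' r (1 - y - 3 * r)"
        by (simp add: diff3_def G'_def algebra_simps)
      then show ?thesis using w[of r "1 - y - 3 * r"] that by simp
    qed
    have N': "\<bar>G t\<bar> \<le> N" if "0 \<le> t" "t \<le> 1" for t using that N(1)[of "1 - t"] eq(1)[of "1 - t"] by (simp add: G_def)
    have x': "0 \<le> 1 - x" "1 - x \<le> 1 / 2" using x False by auto
    note A = quadratic_approximation_left[OF G c' s w' x' N' N(2)]
    have 1: "\<bar>f' x\<bar> \<le> 6000000 * N" using A(1) eq(2)[OF x] by (simp add: G'_def)
    from A(2) obtain a where a: "\<bar>a\<bar> \<le> 6000000 * N"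
      and b: "\<And>t. t \<in> {0..1} \<Longrightarrow> \<bar>G t - G (1 - x) - G' (1 - x) * (t - (1 - x)) - a * (t - (1 - x))\<^sup>2\<bar>
        \<le> 6000000 * (omega3 f' s * \<bar>t - (1 - x)\<bar> + N * \<bar>t - (1 - x)\<bar> ^ 3)" by blast
    have "\<bar>f t - f x - f' x * (t - x) - a * (t - x)\<^sup>2\<bar>
        \<le> 6000000 * (omega3 f' s * \<bar>t - x\<bar> + N * \<bar>t - x\<bar> ^ 3)" if t: "t \<in> {0..1}" for t
    proof -
      have e: "1 - t - (1 - x) = - (t - x)" and "G (1 - t) = f t" "G (1 - x) = f x" "G' (1 - x) = - f' x"
        using eq(1)[OF t] eq(1)[OF x] eq(2)[OF x] by (simp_all add: G_def G'_def)
      moreover have "1 - t \<in> {0..1}" using t by simp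
      ultimately have "\<bar>f t - f x - (- f' x) * (- (t - x)) - a * (- (t - x))\<^sup>2\<bar>
          \<le> 6000000 * (omega3 f' s * \<bar>- (t - x)\<bar> + N * \<bar>- (t - x)\<bar> ^ 3)"
        using b[of "1 - t"] unfolding e by simp
      then show ?thesis unfolding abs_minus_cancel power2_minus minus_mult_minus .
    qed
    then show ?thesis using 1 a by blast
  qed
  then show "\<bar>f' x\<bar> \<le> 6000000 * N"
    and "\<exists>a. \<bar>a\<bar> \<le> 6000000 * N \<and> (\<forall>t\<in>{0..1}. \<bar>f t - f x - f' x * (t - x) - a * (t - x)\<^sup>2\<bar>
      \<le> 6000000 * (omega3 f' s * \<bar>t - x\<bar> + N * \<bar>t - x\<bar> ^ 3))" by auto
qed

section \<open>The estimate\<close>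

text \<open>Since \<open>n \<ge> 1\<close> gives \<open>\<rho> \<le> N\<close>, one has
  \<open>d \<le> 1\<close>, and the quotients in the third and fourth moments are bounded by
  absolute multiples of \<open>d\<close>: \<open>(\<rho> + 2) / (N + 2) \<le> 2 d\<close> serves
  both, and \<open>2 + 3\<close> gives the constant 5.\<close>

lemma mean_functional_paltanea:
  fixes \<rho> x :: real and n :: nat
  assumes \<rho>: "\<rho> > 0" and n: "n \<ge> 1" and x: "x \<in> {0..1}"
  shows "mean_functional (\<lambda>f. paltanea \<rho> n f x) x ((\<rho> + 1) / (real n * \<rho> + 1))"
proof -
  define N where "N = real n * \<rho>"
  define d where "d = (\<rho> + 1) / (N + 1)"
  define X where "X = x * (1 - x)"
  define e where "e i = paltanea \<rho> n (\<lambda>t. t ^ i) x" for i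
  have "1 * \<rho> \<le> real n * \<rho>" using n \<rho> by (intro mult_right_mono) auto
  then have N: "\<rho> \<le> N" "0 < N" using \<rho> by (auto simp: N_def)
  have d: "0 < d" "d \<le> 1" using N \<rho> by (auto simp: d_def)
  have X: "0 \<le> X" using x by (simp add: X_def)
  have X4: "X \<le> 1 / 4"
    using zero_le_power2[of "x - 1 / 2"] by (simp add: X_def power2_eq_square algebra_simps)
  note moments = paltanea_moments[OF \<rho> n, of x, folded N_def, folded e_def]
  have c: "continuous_on {0..1} (\<lambda>t. a * t ^ i)" for a :: real and i by (intro continuous_intros)
  \<comment> \<open>Linearity is recorded for two to five monomials, the numbers of terms in the
    expansions of the first four powers of \<open>t - x\<close>.\<close>
  have L1: "paltanea \<rho> n (\<lambda>t. a * t ^ i + b * t ^ j) x = a * e i + b * e j" for a b i j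
    using paltanea_add[OF \<rho> c c, of n a i b j x] by (simp add: paltanea_cmult e_def)
  note c1 = continuous_on_add[OF c c]
  have L2: "paltanea \<rho> n (\<lambda>t. a * t ^ i + b * t ^ j + a' * t ^ i') x = a * e i + b * e j + a' * e i'"
    for a b a' i j i'
    using paltanea_add[OF \<rho> c1 c, of n a i b j a' i' x] by (simp add: paltanea_cmult e_def[symmetric] L1)
  note c2 = continuous_on_add[OF c1 c]
  have L3: "paltanea \<rho> n (\<lambda>t. a * t ^ i + b * t ^ j + a' * t ^ i' + b' * t ^ j') x
      = a * e i + b * e j + a' * e i' + b' * e j'"
    for a b a' b' i j i' j'
    using paltanea_add[OF \<rho> c2 c, of n a i b j a' i' b' j' x] by (simp add: paltanea_cmult e_def[symmetric] L2)
  note c3 = continuous_on_add[OF c2 c]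
  have L4: "paltanea \<rho> n (\<lambda>t. a * t ^ i + b * t ^ j + a' * t ^ i' + b' * t ^ j' + a'' * t ^ i'') x
      = a * e i + b * e j + a' * e i' + b' * e j' + a'' * e i''"
    for a b a' b' a'' i j i' j' i''
    using paltanea_add[OF \<rho> c3 c, of n a i b j a' i' b' j' a'' i'' x]
    by (simp add: paltanea_cmult e_def[symmetric] L3)
  have "paltanea \<rho> n (\<lambda>t. t - x) x = paltanea \<rho> n (\<lambda>t. 1 * t ^ 1 + (- x) * t ^ 0) x" by simp
  also have "\<dots> = 0" unfolding L1 moments(1,2) by simp
  finally have m1: "paltanea \<rho> n (\<lambda>t. t - x) x = 0" .
  have "paltanea \<rho> n (\<lambda>t. (t - x)\<^sup>2) x
      = paltanea \<rho> n (\<lambda>t. 1 * t ^ 2 + (- 2 * x) * t ^ 1 + x\<^sup>2 * t ^ 0) x"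
    by (simp add: power2_diff algebra_simps)
  also have "\<dots> = e 2 - 2 * x * e 1 + x\<^sup>2" unfolding L2 moments(1) by simp
  also have "\<dots> = X * d" unfolding moments(3) by (simp add: X_def d_def)
  finally have m2: "paltanea \<rho> n (\<lambda>t. (t - x)\<^sup>2) x = X * d" .
  have "paltanea \<rho> n (\<lambda>t. (t - x) ^ 3) x
      = paltanea \<rho> n (\<lambda>t. 1 * t ^ 3 + (- 3 * x) * t ^ 2 + (3 * x\<^sup>2) * t ^ 1 + (- (x ^ 3)) * t ^ 0) x"
    by (rule arg_cong[where f = "\<lambda>u. paltanea \<rho> n u x"]) (auto simp: algebra_simps eval_nat_numeral)
  also have "\<dots> = e 3 - 3 * x * e 2 + 3 * x\<^sup>2 * e 1 - x ^ 3" unfolding L3 moments(1) by simp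
  also have "\<dots> = X * (1 - 2 * x) * (\<rho> + 1) * (\<rho> + 2) / ((N + 1) * (N + 2))"
    unfolding moments(4) by (simp add: X_def)
  also have "\<dots> = X * d * ((1 - 2 * x) * ((\<rho> + 2) / (N + 2)))"
    by (simp add: d_def)
  finally have "\<bar>paltanea \<rho> n (\<lambda>t. (t - x) ^ 3) x\<bar> = X * d * (\<bar>1 - 2 * x\<bar> * ((\<rho> + 2) / (N + 2)))"
    using X d \<rho> N by (simp add: abs_mult)
  moreover have \<rho>2: "(\<rho> + 2) / (N + 2) \<le> 2 * d"
  proof -
    have "(\<rho> + 2) * (N + 1) \<le> 2 * (\<rho> + 1) * (N + 2)"
      using \<rho> N by (simp add: algebra_simps add_increasing)
    then show ?thesis using \<rho> N by (simp add: d_def field_simps)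
  qed
  moreover have "X * d * (\<bar>1 - 2 * x\<bar> * ((\<rho> + 2) / (N + 2))) \<le> X * d * (1 * (2 * d))"
    using \<rho>2 X d x \<rho> N by (intro mult_left_mono mult_mono) auto
  ultimately have m3: "\<bar>paltanea \<rho> n (\<lambda>t. (t - x) ^ 3) x\<bar> \<le> 2 * (X * d\<^sup>2)"
    by (simp add: power2_eq_square)
  have "paltanea \<rho> n (\<lambda>t. (t - x) ^ 4) x
      = paltanea \<rho> n (\<lambda>t. 1 * t ^ 4 + (- 4 * x) * t ^ 3 + (6 * x\<^sup>2) * t ^ 2 + (- 4 * x ^ 3) * t ^ 1 + x ^ 4 * t ^ 0) x"
    by (rule arg_cong[where f = "\<lambda>u. paltanea \<rho> n u x"]) (auto simp: algebra_simps eval_nat_numeral)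
  also have "\<dots> = e 4 - 4 * x * e 3 + 6 * x\<^sup>2 * e 2 - 4 * x ^ 3 * e 1 + x ^ 4"
    unfolding L4 moments(1) by simp
  also have "\<dots> = X * d * (((\<rho> + 2) * (\<rho> + 3) + X * (3 * (\<rho> + 1) * N - 6 * (\<rho>\<^sup>2 + 3 * \<rho> + 3))) / ((N + 2) * (N + 3)))"
    unfolding moments(5) by (simp add: X_def d_def)
  also have "\<dots> \<le> X * d * (5 * d)"
  proof (intro mult_left_mono)
    \<comment> \<open>The negative part of the fourth moment is dropped, which only enlarges
      it.\<close>
    have "X * (3 * (\<rho> + 1) * N - 6 * (\<rho>\<^sup>2 + 3 * \<rho> + 3)) \<le> X * (3 * (\<rho> + 1) * N)"
    proof (intro mult_left_mono)
      have "0 \<le> \<rho>\<^sup>2 + 3 * \<rho> + 3" using \<rho> by (intro add_nonneg_nonneg) auto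
      then have "0 \<le> 6 * (\<rho>\<^sup>2 + 3 * \<rho> + 3)" by (intro mult_nonneg_nonneg) auto
      from diff_left_mono[OF this]
      show "3 * (\<rho> + 1) * N - 6 * (\<rho>\<^sup>2 + 3 * \<rho> + 3) \<le> 3 * (\<rho> + 1) * N"
        unfolding diff_0_right .
    qed (fact X)
    also have "\<dots> \<le> 1 * (3 * (\<rho> + 1) * N)" using X4 \<rho> N by (intro mult_right_mono) auto
    finally have "((\<rho> + 2) * (\<rho> + 3) + X * (3 * (\<rho> + 1) * N - 6 * (\<rho>\<^sup>2 + 3 * \<rho> + 3))) / ((N + 2) * (N + 3))
        \<le> ((\<rho> + 2) * (\<rho> + 3) + 3 * (\<rho> + 1) * N) / ((N + 2) * (N + 3))"
      using N by (intro divide_right_mono) auto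
    also have "\<dots> = (\<rho> + 2) / (N + 2) * ((\<rho> + 3) / (N + 3)) + 3 * ((\<rho> + 1) / (N + 2)) * (N / (N + 3))"
      by (simp only: add_divide_distrib[of "(\<rho> + 2) * (\<rho> + 3)"] times_divide_eq_left times_divide_eq_right divide_divide_eq_left)
    also have "\<dots> \<le> 2 * d * 1 + 3 * d * 1"
    proof (rule add_mono)
      show "(\<rho> + 2) / (N + 2) * ((\<rho> + 3) / (N + 3)) \<le> 2 * d * 1"
        by (rule mult_mono) (use \<rho> N \<rho>2 d in auto)
      have "3 * ((\<rho> + 1) / (N + 2)) \<le> 3 * d"
        unfolding d_def using \<rho> N by (intro mult_left_mono divide_left_mono) auto
      then show "3 * ((\<rho> + 1) / (N + 2)) * (N / (N + 3)) \<le> 3 * d * 1"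
        by (rule mult_mono) (use N d in auto)
    qed
    finally show "((\<rho> + 2) * (\<rho> + 3) + X * (3 * (\<rho> + 1) * N - 6 * (\<rho>\<^sup>2 + 3 * \<rho> + 3))) / ((N + 2) * (N + 3)) \<le> 5 * d"
      by simp
  qed (use X d in auto)
  finally have m4: "paltanea \<rho> n (\<lambda>t. (t - x) ^ 4) x \<le> 5 * (X * d\<^sup>2)"
    by (simp add: power2_eq_square)
  have "mean_functional (\<lambda>f. paltanea \<rho> n f x) x d"
  proof
    show "paltanea \<rho> n (\<lambda>t. 1) x = 1" using moments(1) by (simp add: e_def)
  qed (use x d m1 m2 m3 m4 in \<open>auto simp: X_def paltanea_add[OF \<rho>] paltanea_cmult intro!: paltanea_mono[OF \<rho> x]\<close>)
  then show ?thesis by (simp add: d_def N_def)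
qed

text \<open>The constant is \<open>81 K\<^sup>2\<close>, where \<open>K\<close> comes from the
  quadratic approximation: 80 copies from the covariance estimate and one from replacing the exact
  variance factor \<open>\<delta>\<close> by \<open>(\<rho> + 1) / (\<rho> n)\<close>.\<close>

lemma gruess_voronovskaya_paltanea:
  fixes \<rho> x :: real and n :: nat
  assumes f: "C1_01 f f'" and g: "C1_01 g g'" and \<rho>: "\<rho> > 0" and n: "n \<ge> 1" and x: "x \<in> {0..1}"
  defines "\<delta> \<equiv> (\<rho> + 1) / (real n * \<rho> + 1)"
  defines "vf \<equiv> omega3 f' (\<delta> powr (1/6))" and "vg \<equiv> omega3 g' (\<delta> powr (1/6))"
  shows "real n * \<bar>paltanea \<rho> n (\<lambda>t. f t * g t) x - paltanea \<rho> n f x * paltanea \<rho> n g x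
      - (\<rho> + 1) / (\<rho> * real n) * x * (1 - x) * f' x * g' x\<bar>
    \<le> (81 * 6000000\<^sup>2) * ((\<rho> + 1) / \<rho>) * x * (1 - x) *
      (vf * vg + supnorm f' * vg + supnorm g' * vf
        + max (sqrt \<delta> * supnorm f) vf * max (sqrt \<delta> * supnorm g) vg)"
proof -
  interpret mean_functional "\<lambda>f. paltanea \<rho> n f x" x \<delta>
    unfolding \<delta>_def using \<rho> n x by (rule mean_functional_paltanea)
  define s where "s = \<delta> powr (1/6)"
  define K :: real where "K = 6000000"
  define X where "X = x * (1 - x)"
  define q where "q = sqrt \<delta>"
  define Mf Mg where "Mf = max (q * supnorm f) vf" and "Mg = max (q * supnorm g) vg"
  \<comment> \<open>This quotient dominates both \<open>\<bar>f t\<bar>\<close> and the modulus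
    divided by \<open>s ^ 3 = q\<close>, which are the two bounds the quadratic approximation
    requires.\<close>
  define Nf Ng where "Nf = Mf / q" and "Ng = Mg / q"
  have \<delta>: "0 < \<delta>" "\<delta> \<le> 1" by (fact d)+
  have q: "0 < q" "q * q = \<delta>" using \<delta> by (auto simp: q_def)
  have s: "0 < s" "s \<le> 1" using \<delta> by (auto simp: s_def powr_le1)
  have s3: "s ^ 3 = q"
    using \<delta> by (simp add: s_def q_def powr_power powr_half_sqrt)
  have X: "0 \<le> X" using x by (simp add: X_def)
  note cf = conjunct1[OF C1_01_continuous[OF f]] conjunct2[OF C1_01_continuous[OF f]]
  note cg = conjunct1[OF C1_01_continuous[OF g]] conjunct2[OF C1_01_continuous[OF g]]
  have w: "0 \<le> vf" "vf \<le> Mf" "0 \<le> vg" "vg \<le> Mg"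
    using omega3_nonneg[OF cf(2) s(1)] omega3_nonneg[OF cg(2) s(1)]
    by (auto simp: vf_def vg_def s_def Mf_def Mg_def)
  have MN: "Mf = sqrt \<delta> * Nf" "Mg = sqrt \<delta> * Ng" using q by (auto simp: Nf_def Ng_def q_def)
  have Nf: "\<bar>f t\<bar> \<le> Nf" and Ng: "\<bar>g t\<bar> \<le> Ng" if "t \<in> {0..1}" for t
  proof -
    have "q * \<bar>f t\<bar> \<le> q * supnorm f" "q * \<bar>g t\<bar> \<le> q * supnorm g"
      using supnorm_bound[OF cf(1) that] supnorm_bound[OF cg(1) that] q by simp_all
    then have "q * \<bar>f t\<bar> \<le> Mf" "q * \<bar>g t\<bar> \<le> Mg" by (auto simp: Mf_def Mg_def)
    then show "\<bar>f t\<bar> \<le> Nf" "\<bar>g t\<bar> \<le> Ng" using q by (simp_all add: Nf_def Ng_def field_simps)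
  qed
  have wN: "omega3 f' s \<le> s ^ 3 * Nf" "omega3 g' s \<le> s ^ 3 * Ng"
    unfolding s3 q_def using w MN by (simp_all add: vf_def vg_def s_def)
  note af = quadratic_approximation[OF f s x Nf wN(1), folded K_def, unfolded s_def, folded vf_def]
  note ag = quadratic_approximation[OF g s x Ng wN(2), folded K_def, unfolded s_def, folded vg_def]
  from af(2) obtain a where a: "\<bar>a\<bar> \<le> K * Nf"
    and fa: "\<And>t. t \<in> {0..1} \<Longrightarrow> \<bar>f t - f x - f' x * (t - x) - a * (t - x)\<^sup>2\<bar>
      \<le> K * (vf * \<bar>t - x\<bar> + Nf * \<bar>t - x\<bar> ^ 3)" by blast
  from ag(2) obtain b where b: "\<bar>b\<bar> \<le> K * Ng"
    and gb: "\<And>t. t \<in> {0..1} \<Longrightarrow> \<bar>g t - g x - g' x * (t - x) - b * (t - x)\<^sup>2\<bar>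
      \<le> K * (vg * \<bar>t - x\<bar> + Ng * \<bar>t - x\<bar> ^ 3)" by blast
  define cov where "cov = paltanea \<rho> n (\<lambda>t. f t * g t) x - paltanea \<rho> n f x * paltanea \<rho> n g x"
  define S where "S = vf * vg + supnorm f' * vg + supnorm g' * vf + Mf * Mg"
  define r where "r = (\<rho> + 1) / \<rho>"
  have r: "0 < r" "1 / \<rho> \<le> r" using \<rho> by (simp_all add: r_def divide_right_mono)
  have "vf * vg + \<bar>f' x\<bar> * vg + \<bar>g' x\<bar> * vf + Mf * Mg \<le> S"
    unfolding S_def using w supnorm_bound[OF cf(2) x] supnorm_bound[OF cg(2) x]
    by (intro add_mono mult_right_mono) auto
  moreover have "\<bar>cov - f' x * g' x * (X * \<delta>)\<bar>
      \<le> 80 * K\<^sup>2 * (X * \<delta>) * (vf * vg + \<bar>f' x\<bar> * vg + \<bar>g' x\<bar> * vf + Mf * Mg)"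
    unfolding cov_def X_def
    by (rule covariance_expansion[OF cf(1) cg(1) _ w MN af(1) a ag(1) b fa gb]) (simp_all add: K_def)
  ultimately have "\<bar>cov - f' x * g' x * (X * \<delta>)\<bar> \<le> 80 * K\<^sup>2 * (X * \<delta>) * S"
    using X \<delta> by (elim order_trans) (intro mult_left_mono, auto)
  then have "real n * \<bar>cov - f' x * g' x * (X * \<delta>)\<bar> \<le> real n * (80 * K\<^sup>2 * (X * \<delta>) * S)"
    by (intro mult_left_mono) auto
  also have "\<dots> = 80 * (K\<^sup>2 * (X * S)) * (real n * \<delta>)" by (simp add: mult_ac)
  also have "\<dots> \<le> 80 * (K\<^sup>2 * (X * S)) * r"
  proof (intro mult_left_mono)
    show "real n * \<delta> \<le> r" using \<rho> n by (simp add: \<delta>_def r_def field_simps add_pos_pos)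
    have "0 \<le> supnorm f'" "0 \<le> supnorm g'"
      using supnorm_bound[OF cf(2) x] supnorm_bound[OF cg(2) x] by linarith+
    then show "0 \<le> 80 * (K\<^sup>2 * (X * S))" using X w by (simp add: S_def)
  qed
  finally have main: "real n * \<bar>cov - f' x * g' x * (X * \<delta>)\<bar> \<le> 80 * (K\<^sup>2 * (X * S) * r)" by simp
  have 1: "(\<rho> + 1) / (\<rho> * real n) - \<delta> = \<delta> / \<rho> / real n"
  proof -
    define u where "u = \<rho> * real n"
    have u: "u > 0" using \<rho> n by (simp add: u_def)
    have "(\<rho> + 1) / u - (\<rho> + 1) / (u + 1) = (\<rho> + 1) / (u + 1) / u"
      using u by (simp add: divide_simps) (simp add: algebra_simps)
    then show ?thesis by (simp add: u_def \<delta>_def mult.commute)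
  qed
  have "f' x * g' x * (X * \<delta>) - (\<rho> + 1) / (\<rho> * real n) * X * (f' x * g' x)
      = - (f' x * g' x * X * ((\<rho> + 1) / (\<rho> * real n) - \<delta>))"
    by (simp add: algebra_simps)
  then have "real n * \<bar>f' x * g' x * (X * \<delta>) - (\<rho> + 1) / (\<rho> * real n) * X * (f' x * g' x)\<bar>
      = real n * \<bar>f' x * g' x * X * (\<delta> / \<rho> / real n)\<bar>"
    unfolding 1 by simp
  also have "\<dots> = \<bar>f' x\<bar> * \<bar>g' x\<bar> * (X * \<delta> * (1 / \<rho>))"
    using \<rho> n X \<delta> by (simp add: abs_mult)
  \<comment> \<open>The derivatives are bounded by \<open>K * Nf\<close> and \<open>K * Ng\<close>
    rather than by their norms, because \<open>\<delta> * Nf * Ng\<close> is exactly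
    \<open>Mf * Mg\<close>, a summand of \<open>S\<close>.\<close>
  also have "\<dots> \<le> (K * Nf) * (K * Ng) * (X * \<delta> * r)"
    using af(1) ag(1) X \<delta> r \<rho> by (intro mult_mono) auto
  also have "\<dots> = K\<^sup>2 * (X * (Mf * Mg)) * r"
    unfolding MN q_def[symmetric] q(2)[symmetric] by (simp add: power2_eq_square)
  also have "\<dots> \<le> K\<^sup>2 * (X * S) * r"
  proof -
    have "0 \<le> supnorm f'" "0 \<le> supnorm g'"
      using supnorm_bound[OF cf(2) x] supnorm_bound[OF cg(2) x] by linarith+
    then have "Mf * Mg \<le> S" using w by (simp add: S_def)
    then show ?thesis using X r by (intro mult_right_mono mult_left_mono) auto
  qed
  finally have "real n * \<bar>f' x * g' x * (X * \<delta>) - (\<rho> + 1) / (\<rho> * real n) * X * (f' x * g' x)\<bar>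
      \<le> K\<^sup>2 * (X * S) * r" .
  moreover have triangle: "\<bar>c - z\<bar> \<le> \<bar>c - y\<bar> + \<bar>y - z\<bar>" for c y z :: real by linarith
  have "real n * \<bar>cov - (\<rho> + 1) / (\<rho> * real n) * X * (f' x * g' x)\<bar>
    \<le> real n * (\<bar>cov - f' x * g' x * (X * \<delta>)\<bar>
      + \<bar>f' x * g' x * (X * \<delta>) - (\<rho> + 1) / (\<rho> * real n) * X * (f' x * g' x)\<bar>)"
    by (intro mult_left_mono triangle) simp
  ultimately have "real n * \<bar>cov - (\<rho> + 1) / (\<rho> * real n) * X * (f' x * g' x)\<bar> \<le> 81 * (K\<^sup>2 * (X * S) * r)"
    using main unfolding distrib_left by linarith
  moreover have "81 * (K\<^sup>2 * (X * S) * r) = (81 * K\<^sup>2) * r * x * (1 - x) * S"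
    by (simp add: X_def mult_ac)
  moreover have "(\<rho> + 1) / (\<rho> * real n) * X * (f' x * g' x) = (\<rho> + 1) / (\<rho> * real n) * x * (1 - x) * f' x * g' x"
    by (simp add: X_def)
  ultimately have "real n * \<bar>cov - (\<rho> + 1) / (\<rho> * real n) * x * (1 - x) * f' x * g' x\<bar>
      \<le> (81 * K\<^sup>2) * r * x * (1 - x) * S"
    by (simp only:)
  then show ?thesis unfolding cov_def S_def Mf_def Mg_def q_def r_def K_def .
qed

theorem theorem3p2:
  shows "\<exists>C :: real \<Rightarrow> real.
    (\<forall>\<rho>>0. C \<rho> > 0 \<and>
      (\<forall>f f' g g' (n::nat) x. C1_01 f f' \<longrightarrow> C1_01 g g' \<longrightarrow> n \<ge> 1 \<longrightarrow> x \<in> {0..1} \<longrightarrow>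
        (let \<delta> = (\<rho> + 1) / (real n * \<rho> + 1);
             wf = omega3 f' (\<delta> powr (1/6));
             wg = omega3 g' (\<delta> powr (1/6))
         in real n * \<bar>paltanea \<rho> n (\<lambda>t. f t * g t) x
                     - paltanea \<rho> n f x * paltanea \<rho> n g x
                     - (\<rho> + 1) / (\<rho> * real n) * x * (1 - x) * f' x * g' x\<bar>
            \<le> C \<rho> * ((\<rho> + 1) / \<rho>) * x * (1 - x) *
               (wf * wg + supnorm f' * wg + supnorm g' * wf
                + max (sqrt \<delta> * supnorm f) wf * max (sqrt \<delta> * supnorm g) wg)))) \<and>
    (\<exists>M R. \<forall>\<rho>\<ge>R. C \<rho> \<le> M)"
\<comment> \<open>The witness is a constant function of \<open>\<rho>\<close>, so its boundedness as
  \<open>\<rho>\<close> tends to infinity is immediate.\<close>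
proof (intro exI[of _ "\<lambda>\<rho>. 81 * 6000000\<^sup>2"] conjI allI impI)
  show "\<exists>M R. \<forall>\<rho>\<ge>R::real. 81 * 6000000\<^sup>2 \<le> (M :: real)" by blast
qed (unfold Let_def, simp, rule gruess_voronovskaya_paltanea)

end
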